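(* There exists a special $54$-Brinkhuis $952$-triple. Consequently, the growth rate $s=\lim_{m\to\infty} s_m^{1/m}$ of ternary squarefree words satisfies \[ s \;\geq\; 952^{1/53} \approx 1.1381531 \;>\; 110^{1/42}\approx 1.1184191 . \]
   Context: Let $\Sigma=\{0,1,2\}$. A word over $\Sigma$ is squarefree if it cannot be written as $axxb$ with $x$ nonempty (and $a,b$ possibly empty), i.e., it contains no factor of the form $xx$. Let $s_n$ denote the number of squarefree words of length $n$ over $\Sigma$, and $s=\lim_{m\to\infty} s_m^{1/m}$ (this limit exists). An $n$-Brinkhuis $k$-triple is a triple $\mathcal{B}=\{\mathcal{B}^0,\mathcal{B}^1,\mathcal{B}^2\}$ of sets of words $\mathcal{B}^i=\{w^i_j : 1\le j\le k\}$, where the $w^i_j$ (for fixed $i$, $k$ distinct words) are squarefree words of length $n$ over $\Sigma$, with the property that for every squarefree word $i_1i_2i_3$ with $i_1,i_2,i_3\in\{0,1,2\}$ and all $j_1,j_2,j_3\in\{1,\dots,k\}$, the word $w^{i_1}_{j_1}w^{i_2}_{j_2}w^{i_3}_{j_3}$ of length $3n$ is squarefree. Let $\tau$ be the letter permutation $0\mapsto 1$, $1\mapsto 2$, $2\mapsto 0$, extended letterwise to words. A special $n$-Brinkhuis $k$-triple is an $n$-Brinkhuis $k$-triple with $\mathcal{B}^1=\tau(\mathcal{B}^0)$ and $\mathcal{B}^2=\tau(\mathcal{B}^1)=\tau^2(\mathcal{B}^0)$. *)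

theory Defs
  imports Complex_Main
begin

definition Sigma3 :: "nat set" where
  "Sigma3 = {0, 1, 2}"

(* Named so as not to clash with the constant squarefree of HOL-Computational_Algebra. *)
definition squarefree_word :: "'a list \<Rightarrow> bool" where
  "squarefree_word w \<longleftrightarrow> \<not> (\<exists>a x b. x \<noteq> [] \<and> w = a @ x @ x @ b)"

definition squarefree_words :: "nat \<Rightarrow> nat list set" where
  "squarefree_words n = {w \<in> lists Sigma3. length w = n \<and> squarefree_word w}"

definition squarefree_count :: "nat \<Rightarrow> nat" where
  "squarefree_count n = card (squarefree_words n)"

definition squarefree_root :: "nat \<Rightarrow> real" where
  "squarefree_root m = real (squarefree_count m) powr (1 / real m)"

(* Meaningful only together with convergent squarefree_root. *)
definition growth_rate :: real where
  "growth_rate = lim squarefree_root"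

(* Only the values of B on Sigma3 matter. Each B i is a set of words of the same length over a
   finite alphabet, hence finite, so card (B i) = k says that it consists of k distinct words
   also for k = 0. *)
definition brinkhuis_triple :: "nat \<Rightarrow> nat \<Rightarrow> (nat \<Rightarrow> nat list set) \<Rightarrow> bool" where
  "brinkhuis_triple n k B \<longleftrightarrow>
     (\<forall>i\<in>Sigma3. B i \<subseteq> squarefree_words n \<and> card (B i) = k) \<and>
     (\<forall>i1\<in>Sigma3. \<forall>i2\<in>Sigma3. \<forall>i3\<in>Sigma3. squarefree_word [i1, i2, i3] \<longrightarrow>
        (\<forall>u\<in>B i1. \<forall>v\<in>B i2. \<forall>w\<in>B i3. squarefree_word (u @ v @ w)))"

(* On Sigma3 this is the cyclic permutation 0 -> 1 -> 2 -> 0. *)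
definition tau :: "nat \<Rightarrow> nat" where
  "tau c = (c + 1) mod 3"

definition special_brinkhuis_triple :: "nat \<Rightarrow> nat \<Rightarrow> (nat \<Rightarrow> nat list set) \<Rightarrow> bool" where
  "special_brinkhuis_triple n k B \<longleftrightarrow>
     brinkhuis_triple n k B \<and> B 1 = map tau ` B 0 \<and> B 2 = map tau ` B 1"

end

theory Submission
  imports Defs
begin

text \<open>A Brinkhuis triple gives, for every squarefree word of length \<open>m\<close>, at least \<open>k ^ m\<close> squarefree
  words of length \<open>n * m\<close>: blocks occur in a concatenation only at multiples of \<open>n\<close>, so a square
  that does not fit into three blocks has a period divisible by \<open>n\<close> and comes from a square of
  letters. Hence the growth rate \<open>s\<close> satisfies \<open>s ^ n \<ge> k * s\<close>.

  For the explicit triple, testing all triples of words is hopeless. In \<open>u @ v\<close>, a square with centre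
  in \<open>v\<close> and period \<open>L\<close> exists iff, \<open>m\<close> being the length of the longest common prefix of \<open>v\<close> and
  \<open>drop L v\<close>, the factor of \<open>v\<close> between positions \<open>m\<close> and \<open>L\<close> is a suffix of \<open>u\<close>. So every word
  yields 53 factors to be looked up in a trie of all words, and another 53 after reversal. Squares
  reaching through three words are excluded by bounds on the possible overlaps.\<close>

section \<open>Squarefree words and their growth rate\<close>

text \<open>A condition on triples splits into conditions on pairs because a square through three
  words of length \<open>n\<close> has a period between \<open>n / 2\<close> and
  \<open>3 * n / 2\<close>. Period \<open>n\<close> itself would align the first letters of two
  words that are rotated differently, although the unrotated words all start with 0. For any other
  period, its distance \<open>e\<close> from \<open>n\<close> is the length of an overlap: of the
  middle word with itself if the period is shorter, of the outer words if it is longer. What the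
  square covers on the two sides of this overlap is bounded separately, one side by lookups in the
  given words and the other by lookups in the reversed ones. Only the two bounds are added in the
  end, and no triple is ever inspected.

  Since the three sets are rotations of a single one, only the difference of two rotations matters,
  and it is 1 or 2. Thus one set of words and one pair of tries represent the whole triple. A common
  stem at both ends of all words disposes of most lookups and leaves few possible short
  overlaps.\<close>

lemma squarefree_word_iff_nth:
  "squarefree_word w \<longleftrightarrow>
     \<not> (\<exists>t L. 0 < L \<and> t + 2 * L \<le> length w \<and> (\<forall>j<L. w ! (t + j) = w ! (t + L + j)))"
proof -
  have "(\<exists>a x b. x \<noteq> [] \<and> w = a @ x @ x @ b) \<longleftrightarrow>
     (\<exists>t L. 0 < L \<and> t + 2 * L \<le> length w \<and> (\<forall>j<L. w ! (t + j) = w ! (t + L + j)))"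
    (is "?A \<longleftrightarrow> ?B")
  proof
    assume ?A
    then obtain a x b where x: "x \<noteq> []" and w: "w = a @ x @ x @ b" by blast
    have "w ! (length a + j) = w ! (length a + length x + j)" if "j < length x" for j
      using that unfolding w by (simp add: nth_append)
    then show ?B using x unfolding w
      by (intro exI[of _ "length a"] exI[of _ "length x"]) auto
  next
    assume ?B
    then obtain t L where L: "0 < L" "t + 2 * L \<le> length w"
      and eq: "\<And>j. j < L \<Longrightarrow> w ! (t + j) = w ! (t + L + j)" by blast
    define x where "x = take L (drop t w)"
    have "x = take L (drop (t + L) w)"
      unfolding x_def using L eq by (intro nth_equalityI) (auto simp: add.assoc)
    moreover have "w = take t w @ take L (drop t w) @ take L (drop (t + L) w) @ drop (t + 2 * L) w"
      by (metis append_take_drop_id drop_drop add.commute mult_2 add.left_commute)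
    moreover have "x \<noteq> []" using L by (auto simp: x_def)
    ultimately show ?A using x_def by metis
  qed
  then show ?thesis by (simp add: squarefree_word_def)
qed

lemma squarefree_word_factor:
  assumes "squarefree_word (a @ w @ b)"
  shows "squarefree_word w"
  unfolding squarefree_word_def
proof (rule notI, elim exE conjE)
  fix c x d assume "x \<noteq> []" "w = c @ x @ x @ d"
  then have "a @ w @ b = (a @ c) @ x @ x @ (d @ b)" by simp
  with \<open>x \<noteq> []\<close> assms show False unfolding squarefree_word_def by blast
qed

lemma squarefree_word_take: "squarefree_word w \<Longrightarrow> squarefree_word (take k w)"
  using squarefree_word_factor[of "[]" "take k w" "drop k w"] by simp

lemma squarefree_word_drop: "squarefree_word w \<Longrightarrow> squarefree_word (drop k w)"
  using squarefree_word_factor[of "take k w" "drop k w" "[]"] by simp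

lemma squarefree_word_map:
  assumes "inj_on f (set w)"
  shows "squarefree_word (map f w) \<longleftrightarrow> squarefree_word w"
proof -
  have "(\<forall>j<L. map f w ! (t + j) = map f w ! (t + L + j)) \<longleftrightarrow> (\<forall>j<L. w ! (t + j) = w ! (t + L + j))"
    if "t + 2 * L \<le> length w" for t L
    using that by (auto simp: inj_on_eq_iff[OF assms])
  then show ?thesis unfolding squarefree_word_iff_nth length_map by blast
qed

lemma squarefree_word_3: "squarefree_word [a, b, c] \<longleftrightarrow> a \<noteq> b \<and> b \<noteq> c"
proof -
  have "(\<exists>t L. 0 < L \<and> t + 2 * L \<le> length [a, b, c] \<and>
      (\<forall>j<L. [a, b, c] ! (t + j) = [a, b, c] ! (t + L + j))) \<longleftrightarrow> a = b \<or> b = c"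
  proof (intro iffI; (elim exE conjE)?)
    fix t L :: nat
    assume L: "0 < L" "t + 2 * L \<le> length [a, b, c]"
      and eq: "\<forall>j<L. [a, b, c] ! (t + j) = [a, b, c] ! (t + L + j)"
    from L have "L = 1 \<and> (t = 0 \<or> t = 1)" by auto
    with eq show "a = b \<or> b = c" by auto
  next
    assume "a = b \<or> b = c"
    then show "\<exists>t L. 0 < L \<and> t + 2 * L \<le> length [a, b, c] \<and>
      (\<forall>j<L. [a, b, c] ! (t + j) = [a, b, c] ! (t + L + j))"
    proof
      assume "a = b"
      then show ?thesis by (intro exI[of _ 0] exI[of _ 1]) simp
    next
      assume "b = c"
      then show ?thesis by (intro exI[of _ 1] exI[of _ 1]) simp
    qed
  qed
  then show ?thesis unfolding squarefree_word_iff_nth by blast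
qed

lemma finite_squarefree_words: "finite (squarefree_words n)"
proof (rule finite_subset)
  show "squarefree_words n \<subseteq> {w. set w \<subseteq> Sigma3 \<and> length w = n}"
    by (auto simp: squarefree_words_def)
  show "finite {w. set w \<subseteq> Sigma3 \<and> length w = n}"
    by (intro finite_lists_length_eq) (simp add: Sigma3_def)
qed

text \<open>Cutting after \<open>a\<close> letters is injective and leaves two squarefree parts. In
  logarithms this is the subadditivity behind the existence of the limit.\<close>

lemma squarefree_count_add_le:
  "squarefree_count (a + b) \<le> squarefree_count a * squarefree_count b"
proof -
  let ?f = "\<lambda>w. (take a w, drop a w)"
  have "inj_on ?f (squarefree_words (a + b))"
    by (rule inj_onI) (metis append_take_drop_id prod.inject)
  moreover have "?f ` squarefree_words (a + b) \<subseteq> squarefree_words a \<times> squarefree_words b"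
    by (auto simp: squarefree_words_def squarefree_word_take squarefree_word_drop
        dest: in_set_takeD in_set_dropD)
  ultimately have "card (squarefree_words (a + b)) \<le> card (squarefree_words a \<times> squarefree_words b)"
    by (intro card_inj_on_le) (auto intro: finite_squarefree_words)
  then show ?thesis by (simp add: squarefree_count_def card_cartesian_product)
qed

text \<open>Fekete's lemma; the limit is the infimum \<open>l\<close> of the quotients. With
  \<open>m\<close> fixed such that \<open>g m / m\<close> is close to \<open>l\<close>, division of
  \<open>n\<close> by \<open>m\<close> leaves a remainder whose contribution is at most
  \<open>K\<close> and vanishes after division by \<open>n\<close>.\<close>

lemma fekete_convergent:
  fixes g :: "nat \<Rightarrow> real"
  assumes nonneg: "\<And>n. 0 \<le> g n" and sub: "\<And>m n. g (m + n) \<le> g m + g n"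
  shows "convergent (\<lambda>n. g n / real n)"
proof -
  define l where "l = Inf ((\<lambda>n. g n / real n) ` {1..})"
  have bdd: "bdd_below ((\<lambda>n. g n / real n) ` {1..})"
    by (rule bdd_belowI[of _ 0]) (auto simp: nonneg)
  have lower: "l \<le> g n / real n" if "n \<ge> 1" for n
    unfolding l_def using that bdd by (intro cInf_lower) auto
  \<comment> \<open>\<open>g 0\<close> may be positive, hence the restriction to
    \<open>q \<ge> 1\<close>.\<close>
  have mult: "g (q * m) \<le> real q * g m" if "q \<ge> 1" for q m
    using that
  proof (induction q rule: dec_induct)
    case (step q)
    have "g (Suc q * m) \<le> g m + g (q * m)" using sub[of m "q * m"] by simp
    with step.IH show ?case by (simp add: algebra_simps)
  qed simp
  have "(\<lambda>n. g n / real n) \<longlonglongrightarrow> l"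
  proof (rule LIMSEQ_I)
    fix e :: real assume "0 < e"
    then have "\<exists>x\<in>(\<lambda>n. g n / real n) ` {1..}. x < l + e / 2"
      unfolding l_def using bdd cInf_less_iff[of "(\<lambda>n. g n / real n) ` {1..}" "l + e / 2"]
      by (simp add: l_def)
    then obtain m where m: "m \<ge> 1" "g m / real m < l + e / 2" by auto
    define K where "K = Max (g ` {..<m})"
    have K: "g r \<le> K" if "r < m" for r unfolding K_def using that by (intro Max_ge) auto
    have K0: "0 \<le> K" using K[of 0] nonneg[of 0] m by linarith
    obtain N :: nat where N: "2 * K / e < real N" using reals_Archimedean2 by blast
    have "norm (g n / real n - l) < e" if n: "n \<ge> max (max N 1) m" for n
    proof -
      have n0: "n \<ge> 1" "n \<ge> N" "n \<ge> m" using n by auto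
      define q r where "q = n div m" and "r = n mod m"
      have nqr: "n = q * m + r" "r < m" using m by (auto simp: q_def r_def)
      have q1: "q \<ge> 1" using n0(3) m by (simp add: q_def div_greater_zero_iff Suc_le_eq)
      have "g n \<le> g (q * m) + g r" using sub[of "q * m" r] nqr by simp
      also have "\<dots> \<le> real q * g m + K" using mult[OF q1] K[OF nqr(2)] by (intro add_mono) auto
      also have "real q * g m = real (q * m) * (g m / real m)" using m by simp
      also have "\<dots> \<le> real n * (g m / real m)"
        using nqr nonneg[of m] by (intro mult_right_mono) auto
      finally have "g n \<le> real n * (g m / real m) + K" by simp
      then have "g n / real n \<le> g m / real m + K / real n"
        using n0 by (simp add: field_simps)
      also have "K / real n < e / 2"
      proof -
        have "2 * K < e * real N" using N \<open>0 < e\<close> by (simp add: field_simps)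
        also have "\<dots> \<le> e * real n" using n0 \<open>0 < e\<close> by simp
        finally show ?thesis using n0 by (simp add: field_simps)
      qed
      finally have "g n / real n < l + e" using m(2) by linarith
      with lower[OF n0(1)] show ?thesis by (simp add: abs_if)
    qed
    then show "\<exists>no. \<forall>n\<ge>no. norm (g n / real n - l) < e" by blast
  qed
  then show ?thesis by (rule convergentI)
qed

section \<open>Lists chosen componentwise from given sets\<close>

lemma finite_listset: "(\<And>A. A \<in> set As \<Longrightarrow> finite A) \<Longrightarrow> finite (listset As)"
  by (induction As) (auto simp: set_Cons_def finite_image_set2)

lemma card_listset: "card (listset As) = prod_list (map card As)"
proof (induction As)
  case (Cons A As)
  have "set_Cons A (listset As) = (\<lambda>(x, xs). x # xs) ` (A \<times> listset As)"
    by (auto simp: set_Cons_def)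
  moreover have "inj_on (\<lambda>(x, xs). x # xs) (A \<times> listset As)" by (auto simp: inj_on_def)
  ultimately have "card (set_Cons A (listset As)) = card (A \<times> listset As)"
    by (simp add: card_image)
  with Cons show ?case by (simp add: card_cartesian_product)
qed simp

lemma in_listset_iff: "xs \<in> listset As \<longleftrightarrow> length xs = length As \<and> (\<forall>j<length As. xs ! j \<in> As ! j)"
proof (induction As arbitrary: xs)
  case (Cons A As)
  show ?case
  proof (cases xs)
    case (Cons x ys)
    then show ?thesis using Cons.IH[of ys]
      by (auto simp: set_Cons_def nth_Cons split: nat.splits)
  qed (simp add: set_Cons_def)
qed simp

section \<open>Brinkhuis triples bound the growth rate\<close>

context
  fixes n k :: nat and B :: "nat \<Rightarrow> nat list set"
  assumes triple: "brinkhuis_triple n k B" and n: "0 < n"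
begin

lemma brinkhuis_subset: "i \<in> Sigma3 \<Longrightarrow> B i \<subseteq> squarefree_words n"
  using triple by (simp add: brinkhuis_triple_def)

lemma brinkhuis_length: "i \<in> Sigma3 \<Longrightarrow> u \<in> B i \<Longrightarrow> length u = n"
  using brinkhuis_subset by (auto simp: squarefree_words_def)

lemma brinkhuis_three:
  assumes "a \<in> Sigma3" "b \<in> Sigma3" "c \<in> Sigma3" "a \<noteq> b" "b \<noteq> c" "u \<in> B a" "v \<in> B b" "w \<in> B c"
  shows "squarefree_word (u @ v @ w)"
  using triple assms by (auto simp: brinkhuis_triple_def squarefree_word_3)

lemma brinkhuis_two:
  assumes "a \<in> Sigma3" "b \<in> Sigma3" "a \<noteq> b" "u \<in> B a" "v \<in> B b"
  shows "squarefree_word (u @ v)"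
  using squarefree_word_factor[of "[]" "u @ v" u] brinkhuis_three[of a b a u v u] assms by auto

lemma brinkhuis_disjoint:
  assumes "a \<in> Sigma3" "b \<in> Sigma3" "u \<in> B a" "u \<in> B b"
  shows "a = b"
proof (rule ccontr)
  assume "a \<noteq> b"
  then have "squarefree_word (u @ u)" using brinkhuis_two assms by blast
  moreover have "u \<noteq> []" using brinkhuis_length[OF assms(1,3)] n by auto
  ultimately show False unfolding squarefree_word_def by (metis append_Nil append_Nil2 append.assoc)
qed

lemma brinkhuis_aligned:
  assumes "a \<in> Sigma3" "b \<in> Sigma3" "c \<in> Sigma3" "a \<noteq> b" "u \<in> B a" "v \<in> B b" "w \<in> B c"
    and r: "0 < r" "r < n" and w: "w = drop r u @ take r v"
  shows False
proof (cases "c = a")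
  case False
  have "u @ w = take r u @ drop r u @ drop r u @ take r v" unfolding w by simp
  moreover have "drop r u \<noteq> []" using brinkhuis_length[of a u] assms by simp
  moreover have "squarefree_word (u @ w)" using False brinkhuis_two[of a c u w] assms by auto
  ultimately show False unfolding squarefree_word_def by blast
next
  case True
  have "w @ v = drop r u @ take r v @ take r v @ drop r v" unfolding w by simp
  moreover have "take r v \<noteq> []" using brinkhuis_length[of b v] assms by auto
  moreover have "squarefree_word (w @ v)" using True brinkhuis_two[of c b w v] assms by auto
  ultimately show False unfolding squarefree_word_def by blast
qed

section \<open>Concatenations of blocks\<close>

lemma concat_nth_uniform:
  assumes "\<forall>x\<in>set ws. length x = n" "q < length ws" "r < n"
  shows "concat ws ! (q * n + r) = ws ! q ! r"
  using assms
proof (induction ws arbitrary: q)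
  case (Cons x ws)
  show ?case
  proof (cases q)
    case (Suc q')
    have "concat ws ! (q' * n + r) = ws ! q' ! r" using Cons Suc by simp
    then show ?thesis using Cons.prems Suc by (simp add: nth_append add.assoc)
  qed (use Cons.prems in \<open>simp add: nth_append\<close>)
qed simp

lemma length_concat_uniform:
  "\<forall>x\<in>set ws. length x = n \<Longrightarrow> length (concat ws) = length ws * n"
  by (induction ws) auto

lemma squarefree_word_concat:
  assumes w: "w \<in> lists Sigma3" "squarefree_word w" and m: "length w = m" "3 \<le> m"
    and ws: "length ws = m" "\<And>j. j < m \<Longrightarrow> ws ! j \<in> B (w ! j)"
  shows "squarefree_word (concat ws)"
  unfolding squarefree_word_iff_nth
proof (rule notI, elim exE conjE)
  define C where "C = concat ws"
  fix t L assume L: "0 < L" and "t + 2 * L \<le> length (concat ws)"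
    and "\<forall>j<L. concat ws ! (t + j) = concat ws ! (t + L + j)"
  have letter: "w ! j \<in> Sigma3" if "j < m" for j using w(1) m that by (auto simp: in_lists_conv_set)
  have len: "length (ws ! j) = n" if "j < m" for j
    using brinkhuis_length letter ws that by blast
  have uniform: "\<forall>x\<in>set ws. length x = n" using len ws(1) by (auto simp: in_set_conv_nth)
  have tL: "t + 2 * L \<le> m * n"
    using \<open>t + 2 * L \<le> length (concat ws)\<close> length_concat_uniform[OF uniform] ws(1) by simp
  have eq: "C ! (t + j) = C ! (t + L + j)" if "j < L" for j
    using that \<open>\<forall>j<L. _ j\<close> by (simp add: C_def)
  have C: "C ! (q * n + r) = ws ! q ! r" if "q < m" "r < n" for q r
    using concat_nth_uniform[OF uniform] that ws(1) by (simp add: C_def)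
  have nosquare: False if "0 < d" "q + 2 * d \<le> m" "\<And>p. q \<le> p \<Longrightarrow> p < q + d \<Longrightarrow> w ! p = w ! (p + d)"
    for q d
  proof -
    have "\<forall>j<d. w ! (q + j) = w ! (q + d + j)" using that(3) by (simp add: add.commute add.left_commute)
    then show False using w(2) that(1,2) m unfolding squarefree_word_iff_nth by blast
  qed
  have adj: "w ! q \<noteq> w ! Suc q" if "Suc q < m" for q
  proof
    assume "w ! q = w ! Suc q"
    then have "w ! p = w ! (p + 1)" if "q \<le> p" "p < q + 1" for p
      using that by (cases "p = q") auto
    then show False using nosquare[of 1 q] that by simp
  qed
  have same: "w ! p = w ! q" if "p < m" "q < m" "ws ! p = ws ! q" for p q
    using brinkhuis_disjoint[of "w ! p" "w ! q" "ws ! p"] letter ws(2) that by metis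
  define q r where "q = t div n" and "r = t mod n"
  have t: "t = q * n + r" and r: "r < n" using n by (auto simp: q_def r_def)
  show False
  proof (cases "n dvd L")
    case True
    then obtain d where d: "L = d * n" by (metis dvd_def mult.commute)
    with L have d0: "0 < d" by simp
    have shift: "ws ! p ! i = ws ! (p + d) ! i"
      if "t \<le> p * n + i" "p * n + i < t + L" "i < n" for p i
    proof -
      have bound: "(p + d) * n + i < m * n" using that(2) tL d by (simp add: algebra_simps)
      have "p + d < m"
      proof (rule ccontr)
        assume "\<not> p + d < m"
        then have "m * n \<le> (p + d) * n" by (intro mult_right_mono) auto
        with bound show False by simp
      qed
      then have "C ! (p * n + i) = ws ! p ! i" "C ! ((p + d) * n + i) = ws ! (p + d) ! i"
        using C that(3) by simp_all
      moreover have "C ! (p * n + i) = C ! ((p + d) * n + i)"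
        using eq[of "p * n + i - t"] that d by (simp add: algebra_simps)
      ultimately show ?thesis by simp
    qed
    have qd: "q + 2 * d \<le> m"
    proof (rule ccontr)
      assume "\<not> q + 2 * d \<le> m"
      then have "Suc m * n \<le> (q + 2 * d) * n" by (intro mult_right_mono) auto
      with tL d t n show False by (simp add: algebra_simps)
    qed
    have full: "w ! p = w ! (p + d)" if "q < p \<or> (p = q \<and> r = 0)" "p < q + d" for p
    proof -
      have pm: "p < m" "p + d < m" using that(2) qd by auto
      have lo: "t \<le> p * n"
      proof (cases "q < p")
        case True
        then have "Suc q * n \<le> p * n" by (intro mult_right_mono) auto
        then show ?thesis using t r by simp
      qed (use that t in auto)
      have "Suc p * n \<le> (q + d) * n" using that(2) by (intro mult_right_mono) auto
      then have hi: "p * n + n \<le> t + L" using t d by (simp add: algebra_simps)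
      have "ws ! p = ws ! (p + d)"
      proof (rule nth_equalityI)
        fix i assume "i < length (ws ! p)"
        then show "ws ! p ! i = ws ! (p + d) ! i" using shift[of p i] lo hi len pm by simp
      qed (use len pm in simp)
      then show ?thesis by (rule same[OF pm])
    qed
    show False
    proof (cases "r = 0")
      case True
      have "w ! p = w ! (p + d)" if "q \<le> p" "p < q + d" for p
      proof -
        have "q < p \<or> (p = q \<and> r = 0)" using that True by auto
        then show ?thesis using full that by blast
      qed
      then show False using nosquare[OF d0 qd] by blast
    next
      case r0: False
      \<comment> \<open>The square starts strictly inside block \<open>q\<close>, so it ends
        strictly inside block \<open>q + 2 * d\<close>, which therefore exists.\<close>
      have qd': "q + 2 * d < m"
      proof (rule ccontr)
        assume "\<not> q + 2 * d < m"
        then have "m * n \<le> (q + 2 * d) * n" by (intro mult_right_mono) auto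
        with tL d t r0 show False by (simp add: algebra_simps)
      qed
      have m': "q < m" "q + d < m" using qd' by auto
      have "1 * n \<le> d * n" using d0 by (intro mult_right_mono) auto
      then have nL: "n \<le> L" using d by simp
      have suff: "drop r (ws ! q) = drop r (ws ! (q + d))"
      proof (rule nth_equalityI)
        fix i assume "i < length (drop r (ws ! q))"
        then have "i < n - r" using len m' by simp
        then show "drop r (ws ! q) ! i = drop r (ws ! (q + d)) ! i"
          using shift[of q "r + i"] t nL len m' r by simp
      qed (use len m' in simp)
      have pref: "take r (ws ! (q + d)) = take r (ws ! (q + 2 * d))"
      proof (rule nth_equalityI)
        fix i assume "i < length (take r (ws ! (q + d)))"
        then have i: "i < r" using len m' r by simp
        have "Suc q * n \<le> (q + d) * n" using d0 by (intro mult_right_mono) auto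
        then have "t \<le> (q + d) * n + i" using t r by simp
        moreover have "(q + d) * n + i < t + L" using t d i by (simp add: algebra_simps)
        ultimately have "ws ! (q + d) ! i = ws ! (q + d + d) ! i" using shift i r by simp
        then show "take r (ws ! (q + d)) ! i = take r (ws ! (q + 2 * d)) ! i"
          using i by (simp add: mult_2 add.assoc)
      qed (use len m' qd' in simp)
      \<comment> \<open>The inner blocks already agree under the shift by \<open>d\<close>. Equality
        at one of the two ends would complete a square of letters, starting at \<open>q\<close> here
        and at \<open>Suc q\<close> in the next step.\<close>
      have "w ! q \<noteq> w ! (q + d)"
      proof
        assume "w ! q = w ! (q + d)"
        then have "w ! p = w ! (p + d)" if "q \<le> p" "p < q + d" for p
          using full[of p] that by (cases "p = q") auto
        then show False using nosquare[OF d0 qd] by blast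
      qed
      moreover have "w ! (q + d) \<noteq> w ! (q + 2 * d)"
      proof
        assume e: "w ! (q + d) = w ! (q + 2 * d)"
        have "w ! p = w ! (p + d)" if "Suc q \<le> p" "p < Suc q + d" for p
          using that full[of p] e by (cases "p = q + d") (auto simp: mult_2 add.assoc)
        then show False using nosquare[OF d0, of "Suc q"] qd' by simp
      qed
      \<comment> \<open>These blocks need not be adjacent in the concatenation, but their letters
        form a squarefree word of length three, so the condition on triples applies to them.\<close>
      ultimately have sf: "squarefree_word (ws ! q @ ws ! (q + d) @ ws ! (q + 2 * d))"
        using brinkhuis_three letter ws(2) m' qd' by blast
      \<comment> \<open>The left block shares its suffix with the middle one, and the right block
        its prefix. Hence the product contains the square of the middle block cyclically shifted by
        \<open>r\<close>.\<close>
      have split: "take r (ws ! q) @ (drop r (ws ! (q + d)) @ take r (ws ! (q + d)))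
           @ (drop r (ws ! (q + d)) @ take r (ws ! (q + d))) @ drop r (ws ! (q + 2 * d))
         = ws ! q @ ws ! (q + d) @ ws ! (q + 2 * d)"
        using suff pref by (metis append_assoc append_take_drop_id)
      have "drop r (ws ! (q + d)) @ take r (ws ! (q + d)) \<noteq> []"
        using len m' r by simp
      then show False using sf split unfolding squarefree_word_def by metis
    qed
  next
    case False
    \<comment> \<open>A block read at a position that is not a multiple of \<open>n\<close> is a
      suffix of one block followed by a prefix of the next, the situation of
      \<open>brinkhuis_aligned\<close>.\<close>
    have occ: False if "p < m" "s + n \<le> m * n" "\<not> n dvd s" "\<And>i. i < n \<Longrightarrow> C ! (p * n + i) = C ! (s + i)" for p s
    proof -
      define u x where "u = s div n" and "x = s mod n"
      have s: "s = u * n + x" "x < n" "0 < x"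
        using n that(3) by (auto simp: u_def x_def mod_greater_zero_iff_not_dvd)
      have u: "Suc u < m"
      proof (rule ccontr)
        assume "\<not> Suc u < m"
        then have "m * n \<le> Suc u * n" by (intro mult_right_mono) auto
        with that(2) s show False by simp
      qed
      have "ws ! p = drop x (ws ! u) @ take x (ws ! Suc u)"
      proof (rule nth_equalityI)
        show "length (ws ! p) = length (drop x (ws ! u) @ take x (ws ! Suc u))"
          using len that(1) u s by simp
        fix i assume "i < length (ws ! p)"
        then have i: "i < n" using len that(1) by simp
        have e: "ws ! p ! i = C ! (s + i)" using that(4)[OF i] C[OF that(1) i] by simp
        show "ws ! p ! i = (drop x (ws ! u) @ take x (ws ! Suc u)) ! i"
        proof (cases "x + i < n")
          case True
          have "C ! (u * n + (x + i)) = ws ! u ! (x + i)" using C True u by simp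
          moreover have "i < n - x" using True by simp
          ultimately show ?thesis using e s u len by (simp add: nth_append add.assoc)
        next
          case F: False
          have "C ! (Suc u * n + (x + i - n)) = ws ! Suc u ! (x + i - n)"
            using C[OF u, of "x + i - n"] s i by simp
          moreover have "Suc u * n + (x + i - n) = s + i" using s F by simp
          ultimately have "ws ! p ! i = ws ! Suc u ! (x + i - n)" using e by simp
          moreover have "x + i - n < x" "i - (n - x) = x + i - n" "\<not> i < n - x" using i s F by auto
          ultimately show ?thesis using s u len by (simp add: nth_append)
        qed
      qed
      moreover have "ws ! p \<in> B (w ! p)" "ws ! u \<in> B (w ! u)" "ws ! Suc u \<in> B (w ! Suc u)"
        using ws(2) that(1) u by simp_all
      moreover have "w ! p \<in> Sigma3" "w ! u \<in> Sigma3" "w ! Suc u \<in> Sigma3"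
        using letter that(1) u by simp_all
      ultimately show False using brinkhuis_aligned adj[OF u] s(2,3) by blast
    qed
    \<comment> \<open>A window of three blocks starting where the square starts, moved back if it
      would exceed the word. A moved window reaches to the end of the word and so contains the
      square.\<close>
    define q' where "q' = min q (m - 3)"
    have "q' * n \<le> q * n" by (simp add: q'_def)
    then have q': "q' * n \<le> t" "q' + 2 < m" using t m unfolding q'_def by linarith+
    show False
    proof (cases "t + 2 * L \<le> (q' + 3) * n")
      case True
      let ?W = "ws ! q' @ ws ! Suc q' @ ws ! Suc (Suc q')"
      have W: "?W ! i = C ! (q' * n + i)" if "i < 3 * n" for i
      proof -
        consider "i < n" | "n \<le> i" "i < 2 * n" | "2 * n \<le> i" by linarith
        then show ?thesis
        proof cases
          case 1
          then show ?thesis using C[of q' i] q' len by (simp add: nth_append)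
        next
          case 2
          define i' where "i' = i - n"
          have i: "i = n + i'" "i' < n" using 2 by (auto simp: i'_def)
          have "C ! (q' * n + i) = ws ! Suc q' ! i'"
            using C[of "Suc q'" i'] q' i by (simp add: add.assoc add.left_commute)
          then show ?thesis using i q' len by (simp add: nth_append)
        next
          case 3
          define i' where "i' = i - 2 * n"
          have i: "i = n + (n + i')" "i' < n" using 3 that by (auto simp: i'_def)
          have "C ! (q' * n + i) = ws ! Suc (Suc q') ! i'"
            using C[of "Suc (Suc q')" i'] q' i by (simp add: add.assoc add.left_commute)
          then show ?thesis using i q' len by (simp add: nth_append)
        qed
      qed
      define s where "s = t - q' * n"
      have s: "t = q' * n + s" using q' by (simp add: s_def)
      have bound: "s + 2 * L \<le> 3 * n" using True s by (simp add: algebra_simps)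
      have "squarefree_word ?W"
        using brinkhuis_three[of "w ! q'" "w ! Suc q'" "w ! Suc (Suc q')"] letter ws(2) adj q' by simp
      moreover have "length ?W = 3 * n" using len q' by simp
      moreover have "?W ! (s + j) = ?W ! (s + L + j)" if "j < L" for j
      proof -
        have "s + j < 3 * n" "s + L + j < 3 * n" using that bound by linarith+
        then have "?W ! (s + j) = C ! (t + j)" "?W ! (s + L + j) = C ! (t + L + j)"
          unfolding s by (simp_all only: W add.assoc)
        then show ?thesis using eq[OF that] by metis
      qed
      moreover have "s + 2 * L \<le> length ?W" using bound \<open>length ?W = 3 * n\<close> by simp
      ultimately show False using L unfolding squarefree_word_iff_nth[of ?W] by blast
    next
      case F: False
      have qm: "q' = q"
      proof (rule ccontr)
        assume "q' \<noteq> q"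
        then have "q' + 3 = m" using m by (auto simp: q'_def min_def split: if_splits)
        then show False using F tL by simp
      qed
      have long: "(q + 3) * n < t + 2 * L" using F qm by simp
      have qm3: "q + 2 < m" using q' qm by simp
      \<comment> \<open>The square extends beyond block \<open>q + 2\<close>. If its centre is not
        before the end of block \<open>Suc q\<close>, this block lies in the first half; otherwise
        block \<open>q + 2\<close> lies in the second. Shifting by \<open>L\<close> into the other
        half reads it off the grid.\<close>
      show False
      proof (cases "(q + 2) * n \<le> t + L")
        case True
        show False
        proof (rule occ)
          show "Suc q < m" using qm3 by simp
          show "Suc q * n + L + n \<le> m * n" using True tL by (simp add: algebra_simps)
          show "\<not> n dvd Suc q * n + L" using False by (simp add: dvd_add_right_iff)
          fix i assume i: "i < n"
          define j where "j = Suc q * n + i - t"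
          have "t \<le> Suc q * n" using t r by simp
          then have j: "t + j = Suc q * n + i" by (simp add: j_def)
          have "Suc q * n + n \<le> t + L" using True by (simp add: algebra_simps)
          then have "j < L" using i j by linarith
          moreover have "t + L + j = Suc q * n + L + i" using j by linarith
          ultimately show "C ! (Suc q * n + i) = C ! (Suc q * n + L + i)"
            using eq[of j] j by metis
        qed
      next
        case F2: False
        have ge: "L + t \<le> (q + 2) * n" "t + L \<le> (q + 2) * n" using F2 by auto
        show False
        proof (rule occ)
          show "q + 2 < m" using qm3 by simp
          have "(q + 2) * n + n \<le> m * n"
            using mult_right_mono[of "q + 3" m n] qm3 by (simp add: algebra_simps)
          then show "(q + 2) * n - L + n \<le> m * n" by simp
          show "\<not> n dvd (q + 2) * n - L"
          proof
            assume "n dvd (q + 2) * n - L"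
            moreover have "n dvd (q + 2) * n" by simp
            moreover have "L = (q + 2) * n - ((q + 2) * n - L)" using ge by simp
            ultimately have "n dvd L" by (metis dvd_diff_nat)
            then show False using False by simp
          qed
          fix i assume i: "i < n"
          define j where "j = (q + 2) * n + i - L - t"
          have j: "t + j = (q + 2) * n - L + i" "t + L + j = (q + 2) * n + i"
            using ge unfolding j_def by linarith+
          have "(q + 3) * n = (q + 2) * n + n" by (simp add: algebra_simps)
          then have "j < L" using long i j by linarith
          then show "C ! ((q + 2) * n + i) = C ! ((q + 2) * n - L + i)"
            using eq[of j] j by metis
        qed
      qed
    qed
  qed
qed

text \<open>The pairs of a letter word and a choice of blocks for it are counted. The concatenation
  determines the blocks, which have equal length, and the blocks determine the letters, by
  disjointness.\<close>

lemma squarefree_count_mult_ge: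
  assumes "3 \<le> m"
  shows "k ^ m * squarefree_count m \<le> squarefree_count (m * n)"
proof -
  define S where "S = Sigma (squarefree_words m) (\<lambda>w. listset (map B w))"
  have S: "length w = m" "w \<in> lists Sigma3" "squarefree_word w" "length ws = m"
    "\<And>j. j < m \<Longrightarrow> ws ! j \<in> B (w ! j)" "\<And>j. j < m \<Longrightarrow> w ! j \<in> Sigma3"
    "\<And>x. x \<in> set ws \<Longrightarrow> length x = n" if "(w, ws) \<in> S" for w ws
  proof -
    show *: "length w = m" "w \<in> lists Sigma3" "squarefree_word w" "length ws = m"
      "\<And>j. j < m \<Longrightarrow> ws ! j \<in> B (w ! j)" "\<And>j. j < m \<Longrightarrow> w ! j \<in> Sigma3"
      using that by (auto simp: S_def squarefree_words_def in_listset_iff)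
    show "length x = n" if "x \<in> set ws" for x
    proof -
      obtain j where "j < m" "x = ws ! j" using \<open>x \<in> set ws\<close> *(4) by (auto simp: in_set_conv_nth)
      then show ?thesis using brinkhuis_length *(5,6) by blast
    qed
  qed
  have "card S = (\<Sum>w\<in>squarefree_words m. card (listset (map B w)))"
    unfolding S_def
  proof (rule card_SigmaI)
    show "\<forall>w\<in>squarefree_words m. finite (listset (map B w))"
    proof
      fix w assume "w \<in> squarefree_words m"
      then have "finite (B i)" if "i \<in> set w" for i
        using that finite_subset[OF brinkhuis_subset finite_squarefree_words]
        by (auto simp: squarefree_words_def)
      then show "finite (listset (map B w))" by (intro finite_listset) auto
    qed
  qed (rule finite_squarefree_words)
  also have "\<dots> = (\<Sum>w\<in>squarefree_words m. k ^ m)"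
  proof (rule sum.cong[OF refl])
    fix w assume "w \<in> squarefree_words m"
    then have w: "length w = m" "set w \<subseteq> Sigma3" by (auto simp: squarefree_words_def)
    have "map (card \<circ> B) w = map (\<lambda>_. k) w"
      using w triple by (intro map_cong) (auto simp: brinkhuis_triple_def)
    then have "map (card \<circ> B) w = replicate m k" using w by (simp add: map_replicate_const)
    then show "card (listset (map B w)) = k ^ m" by (simp add: card_listset)
  qed
  finally have "card S = k ^ m * squarefree_count m" by (simp add: squarefree_count_def)
  moreover have "card S \<le> card (squarefree_words (m * n))"
  proof (rule card_inj_on_le)
    show "inj_on (concat \<circ> snd) S"
    proof (rule inj_onI, clarify)
      fix w ws w' ws' assume a: "(w, ws) \<in> S" "(w', ws') \<in> S"
        and "(concat \<circ> snd) (w, ws) = (concat \<circ> snd) (w', ws')"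
      then have "concat ws = concat ws'" by simp
      then have ws: "ws = ws'"
      proof (rule concat_injective)
        show "\<forall>(x, y)\<in>set (zip ws ws'). length x = length y"
        proof clarify
          fix x y assume "(x, y) \<in> set (zip ws ws')"
          then have "x \<in> set ws" "y \<in> set ws'" by (auto dest: set_zip_leftD set_zip_rightD)
          then show "length x = length y" using S(7)[OF a(1)] S(7)[OF a(2)] by simp
        qed
      qed (use S(4)[OF a(1)] S(4)[OF a(2)] in simp)
      have "w = w'"
      proof (rule nth_equalityI)
        fix j assume "j < length w"
        then have "j < m" using S[OF a(1)] by simp
        then show "w ! j = w' ! j"
          using brinkhuis_disjoint[of "w ! j" "w' ! j" "ws ! j"] S[OF a(1)] S[OF a(2)] ws
          by auto
      qed (use S[OF a(1)] S[OF a(2)] in simp)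
      with ws show "w = w' \<and> ws = ws'" by simp
    qed
    show "(concat \<circ> snd) ` S \<subseteq> squarefree_words (m * n)"
    proof clarify
      fix w ws assume a: "(w, ws) \<in> S"
      note * = S[OF a]
      have "squarefree_word (concat ws)"
        using squarefree_word_concat * assms by blast
      moreover have "length (concat ws) = m * n"
        using length_concat_uniform[of ws] * by auto
      moreover have "set x \<subseteq> Sigma3" if "x \<in> set ws" for x
      proof -
        obtain j where "j < m" "x = ws ! j" using \<open>x \<in> set ws\<close> *(4) by (auto simp: in_set_conv_nth)
        then have "w ! j \<in> Sigma3" "x \<in> B (w ! j)" using * by auto
        then have "x \<in> squarefree_words n" using brinkhuis_subset by blast
        then show ?thesis by (auto simp: squarefree_words_def)
      qed
      ultimately show "(concat \<circ> snd) (w, ws) \<in> squarefree_words (m * n)"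
        by (auto simp: squarefree_words_def in_lists_conv_set)
    qed
  qed (rule finite_squarefree_words)
  ultimately show ?thesis by (simp add: squarefree_count_def)
qed

section \<open>Positivity of the counts and the limit\<close>

context
  assumes k: "1 \<le> k" and n2: "2 \<le> n"
begin

text \<open>Needed for the logarithms. The triple itself supplies long words: repeated
  multiplication of the length by \<open>n\<close>, starting from \<open>[0, 1, 0]\<close>, gives
  positive counts at arbitrarily large lengths, and submultiplicativity carries this over to all
  smaller lengths.\<close>

lemma squarefree_count_pos: "1 \<le> squarefree_count m"
proof -
  have "[0, 1, 0] \<in> squarefree_words 3"
    by (auto simp: squarefree_words_def squarefree_word_3 Sigma3_def)
  then have c3: "1 \<le> squarefree_count 3"
    unfolding squarefree_count_def
    by (metis One_nat_def Suc_leI card_gt_0_iff empty_iff finite_squarefree_words)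
  have "\<exists>M. m \<le> M \<and> 3 \<le> M \<and> 1 \<le> squarefree_count M"
  proof (induction m)
    case (Suc m)
    then obtain M where M: "m \<le> M" "3 \<le> M" "1 \<le> squarefree_count M" by blast
    have "1 * 1 \<le> k ^ M * squarefree_count M" using M k by (intro mult_le_mono) auto
    also note squarefree_count_mult_ge[OF M(2)]
    finally have "1 \<le> squarefree_count (M * n)" by simp
    moreover have "M * 2 \<le> M * n" using n2 by simp
    then have "Suc m \<le> M * n" "3 \<le> M * n" using M by linarith+
    ultimately show ?case by blast
  qed (use c3 in blast)
  then obtain M where M: "m \<le> M" "1 \<le> squarefree_count M" by blast
  have "squarefree_count M \<le> squarefree_count m * squarefree_count (M - m)"
    using squarefree_count_add_le[of m "M - m"] M(1) by simp
  then have "squarefree_count m \<noteq> 0" using M(2) by (cases "squarefree_count m = 0") simp_all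
  then show ?thesis by simp
qed

text \<open>At \<open>m = 0\<close> both sides are 1, division by zero being zero.\<close>

lemma squarefree_root_eq: "squarefree_root m = exp (ln (squarefree_count m) / m)"
  using squarefree_count_pos[of m] by (simp add: squarefree_root_def powr_def)

text \<open>With \<open>l\<close> the logarithm of the growth rate, the limit of \<open>step\<close>
  is \<open>(ln k + l) / n \<le> l\<close>. The \<open>l\<close> on the left stems from the choice
  of the letter word and improves the exponent from \<open>1 / n\<close> to
  \<open>1 / (n - 1)\<close>, whence 53 for words of length 54.\<close>

lemma growth_rate_ge:
  shows "convergent squarefree_root" and "growth_rate \<ge> real k powr (1 / (real n - 1))"
proof -
  define g where "g m = ln (real (squarefree_count m))" for m
  have pos: "1 \<le> real (squarefree_count m)" for m using squarefree_count_pos[of m] by linarith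
  have "convergent (\<lambda>m. g m / real m)"
  proof (rule fekete_convergent)
    show "0 \<le> g m" for m using pos by (simp add: g_def)
    show "g (a + b) \<le> g a + g b" for a b
    proof -
      have "real (squarefree_count (a + b)) \<le> real (squarefree_count a) * real (squarefree_count b)"
        using squarefree_count_add_le[of a b] by (metis of_nat_le_iff of_nat_mult)
      then have "g (a + b) \<le> ln (real (squarefree_count a) * real (squarefree_count b))"
        unfolding g_def using pos[of "a + b"] by (intro ln_mono) auto
      also have "\<dots> = g a + g b" unfolding g_def using pos[of a] pos[of b] by (intro ln_mult_pos) auto
      finally show ?thesis .
    qed
  qed
  then obtain l where l: "(\<lambda>m. g m / real m) \<longlonglongrightarrow> l" by (auto simp: convergent_def)
  have root: "squarefree_root = (\<lambda>m. exp (g m / real m))"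
    by (simp add: fun_eq_iff squarefree_root_eq g_def)
  have lim: "squarefree_root \<longlonglongrightarrow> exp l" unfolding root using l by (rule tendsto_exp)
  then show "convergent squarefree_root" by (rule convergentI)
  have rate: "growth_rate = exp l" unfolding growth_rate_def using lim by (rule limI)
  have step: "(ln k + g m / real m) / n \<le> g (m * n) / real (m * n)" if m: "3 \<le> m" for m
  proof -
    have "real k ^ m * squarefree_count m \<le> squarefree_count (m * n)"
      using squarefree_count_mult_ge[OF m] by (metis of_nat_le_iff of_nat_mult of_nat_power)
    moreover have "0 < real k ^ m * squarefree_count m" using pos[of m] k by auto
    ultimately have "ln (real k ^ m * squarefree_count m) \<le> g (m * n)"
      unfolding g_def by (intro ln_mono) auto
    moreover have "ln (real k ^ m * squarefree_count m) = m * ln k + g m"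
      unfolding g_def using pos[of m] k by (simp add: ln_mult_pos ln_realpow)
    ultimately have "(m * ln k + g m) / (m * n) \<le> g (m * n) / real (m * n)"
      by (simp add: divide_right_mono)
    moreover have "(m * ln k + g m) / (m * n) = (ln k + g m / real m) / n"
      using m n by (simp add: field_simps)
    ultimately show ?thesis by simp
  qed
  have "filterlim (\<lambda>m. m * n) at_top sequentially"
    using n by (intro filterlim_subseq) (auto simp: strict_mono_def)
  then have "(\<lambda>m. g (m * n) / real (m * n)) \<longlonglongrightarrow> l"
    using l by (rule filterlim_compose[rotated])
  moreover have "(\<lambda>m. (ln k + g m / real m) / n) \<longlonglongrightarrow> (ln k + l) / n"
    using n by (intro tendsto_intros l) auto
  ultimately have "(ln k + l) / n \<le> l"
    using step by (intro LIMSEQ_le[of "\<lambda>m. (ln k + g m / real m) / n" _ "\<lambda>m. g (m * n) / real (m * n)"]) blast+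
  then have "ln k / (real n - 1) \<le> l" using n2 by (simp add: field_simps)
  then show "growth_rate \<ge> real k powr (1 / (real n - 1))"
    unfolding rate using k by (simp add: powr_def)
qed

end

end

section \<open>Decimal values of the two roots\<close>

lemma powr_inverse_less_iff:
  fixes x y :: real
  assumes "0 < x" "0 < y" "0 < n"
  shows "x < y powr (1 / real n) \<longleftrightarrow> x ^ n < y" and "y powr (1 / real n) < x \<longleftrightarrow> y < x ^ n"
proof -
  have y: "(y powr (1 / real n)) ^ n = y"
    using assms by (simp add: powr_realpow[symmetric] powr_powr)
  have *: "a < b \<longleftrightarrow> a ^ n < b ^ n" if "0 < a" "0 < b" for a b :: real
    using that assms(3) by (metis less_le_not_le linorder_le_less_linear power_mono power_strict_mono less_imp_le)
  show "x < y powr (1 / real n) \<longleftrightarrow> x ^ n < y" using *[of x "y powr (1 / real n)"] assms y by simp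
  show "y powr (1 / real n) < x \<longleftrightarrow> y < x ^ n" using *[of "y powr (1 / real n)" x] assms y by simp
qed

text \<open>The two fractions enclose the root within the permitted distance; their small
  denominators keep the integers in the 53rd powers short.\<close>

lemma powr_952_bounds: "\<bar>(952::real) powr (1 / 53) - 1.1381531\<bar> < 5 / 10 ^ 8"
proof -
  have "(6187 / 5436) ^ 53 < (952::real)" "(952::real) < (15727 / 13818) ^ 53"
    unfolding power_divide by (simp_all add: divide_simps)
  then have "6187 / 5436 < (952::real) powr (1 / 53)" "(952::real) powr (1 / 53) < 15727 / 13818"
    using powr_inverse_less_iff[of "6187 / 5436" "952" 53] powr_inverse_less_iff[of "15727 / 13818" "952" 53] by simp_all
  then show ?thesis unfolding abs_diff_less_iff by simp
qed

lemma powr_110_bounds: "\<bar>(110::real) powr (1 / 42) - 1.1184191\<bar> < 5 / 10 ^ 8"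
proof -
  have "(7414 / 6629) ^ 42 < (110::real)" "(110::real) < (7669 / 6857) ^ 42"
    unfolding power_divide by (simp_all add: divide_simps)
  then have "7414 / 6629 < (110::real) powr (1 / 42)" "(110::real) powr (1 / 42) < 7669 / 6857"
    using powr_inverse_less_iff[of "7414 / 6629" "110" 42] powr_inverse_less_iff[of "7669 / 6857" "110" 42] by simp_all
  then show ?thesis unfolding abs_diff_less_iff by simp
qed

section \<open>Rotated copies of a set of words\<close>

text \<open>The exponent \<open>d\<close> is not reduced modulo 3, so that compositions simply add
  up.\<close>

definition rot :: "nat \<Rightarrow> nat list \<Rightarrow> nat list" where
  "rot d w = map (\<lambda>x. (x + d) mod 3) w"

lemma length_rot [simp]: "length (rot d w) = length w"
  by (simp add: rot_def)

lemma nth_rot [simp]: "i < length w \<Longrightarrow> rot d w ! i = (w ! i + d) mod 3"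
  by (simp add: rot_def)

lemma rev_rot: "rev (rot d w) = rot d (rev w)"
  by (simp add: rot_def rev_map)

lemma rot_rot: "rot c (rot d w) = rot (c + d) w"
  by (simp add: rot_def mod_simps ac_simps)

lemma map_tau: "map tau w = rot 1 w"
  by (simp add: rot_def tau_def)

lemma rot_id: "set w \<subseteq> Sigma3 \<Longrightarrow> rot 0 w = w"
  by (auto simp: rot_def Sigma3_def intro!: map_idI)

lemma squarefree_word_rot:
  assumes "set w \<subseteq> Sigma3"
  shows "squarefree_word (rot d w) \<longleftrightarrow> squarefree_word w"
  unfolding rot_def
proof (rule squarefree_word_map, rule inj_on_inverseI)
  fix x assume "x \<in> set w"
  then have "x < 3" using assms by (auto simp: Sigma3_def)
  then show "((x + d) mod 3 + 2 * d) mod 3 = x" by (simp add: mod_simps)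
qed

text \<open>The fixed first letter gives different rotations different first letters, which excludes
  squares of period exactly \<open>n\<close>. The fixed last letter makes the condition invariant
  under reversal.\<close>

definition alphabet_words :: "nat \<Rightarrow> nat list set \<Rightarrow> bool" where
  "alphabet_words n X \<longleftrightarrow>
     (\<forall>v\<in>X. length v = n \<and> set v \<subseteq> Sigma3 \<and> v ! 0 = 0 \<and> v ! (n - 1) = 0)"

text \<open>The data excluded by \<open>separated\<close> are those of a square of period \<open>L\<close> in \<open>rot d u @ v\<close>
  that has its centre in \<open>v\<close> and begins \<open>a\<close> letters before \<open>v\<close>.\<close>

definition separated :: "nat \<Rightarrow> nat list set \<Rightarrow> bool" where
  "separated n X \<longleftrightarrow> (\<forall>u\<in>X. \<forall>v\<in>X. \<forall>d\<in>{1, 2}. \<forall>a L. 1 \<le> a \<and> a \<le> L \<and> L < n \<and> 2 * L \<le> n + a \<and>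
     (\<forall>i<L - a. v ! i = v ! (L + i)) \<longrightarrow> \<not> (\<forall>i<a. rot d u ! (n - 1 - i) = v ! (L - 1 - i)))"

text \<open>If a square in \<open>u @ v @ w\<close> has a period exceeding \<open>n\<close> by \<open>e\<close>, then \<open>u\<close> ends with the first \<open>e\<close>
  letters of \<open>w\<close>, and \<open>v\<close> splits into a prefix that continues these letters in \<open>w\<close> and a suffix
  that precedes them in \<open>u\<close>. Bounding the lengths of both parts leaves too few letters for \<open>v\<close>.\<close>

definition bounded_overlap :: "nat \<Rightarrow> (nat \<Rightarrow> nat) \<Rightarrow> nat list set \<Rightarrow> bool" where
  "bounded_overlap n h X \<longleftrightarrow> (\<forall>u\<in>X. \<forall>w\<in>X. \<forall>v\<in>X. \<forall>d\<in>{1, 2}. \<forall>e y. 1 \<le> e \<and> 2 * e \<le> n \<and> y \<le> n - e \<and>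
     (\<forall>k<e. u ! (n - e + k) = w ! k) \<and> (\<forall>i<y. u ! (n - e - 1 - i) = rot d v ! (n - 1 - i)) \<longrightarrow> y \<le> h e)"

lemma alphabet_words_rev:
  assumes "alphabet_words n X" "0 < n"
  shows "alphabet_words n (rev ` X)"
  using assms by (auto simp: alphabet_words_def rev_nth)

text \<open>Moves both rotations to one side; \<open>2 * b\<close> stands for the negative of
  \<open>b\<close> modulo 3.\<close>

lemma rot_swap:
  assumes X: "alphabet_words n X" and "u \<in> X" "v \<in> X" "i < n" "j < n"
    and eq: "rot a u ! i = rot b v ! j"
  shows "v ! j = rot ((a + 2 * b) mod 3) u ! i"
proof -
  have "u ! i \<in> set u" "v ! j \<in> set v" using assms by (auto simp: alphabet_words_def)
  then have "u ! i \<in> Sigma3" "v ! j \<in> Sigma3" using X \<open>u \<in> X\<close> \<open>v \<in> X\<close> by (auto simp: alphabet_words_def)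
  then have "u ! i < 3" "v ! j < 3" by (auto simp: Sigma3_def)
  have mod3: "(u ! i + a) mod 3 = (v ! j + b) mod 3"
    using assms by (simp add: alphabet_words_def)
  have "(u ! i + (a + 2 * b) mod 3) mod 3 = ((u ! i + a) mod 3 + 2 * b) mod 3"
    by (simp add: mod_simps ac_simps)
  also have "\<dots> = ((v ! j + b) mod 3 + 2 * b) mod 3" by (simp only: mod3)
  also have "\<dots> = (v ! j + 3 * b) mod 3" by (simp add: mod_simps)
  finally show ?thesis using \<open>v ! j < 3\<close> assms by (simp add: alphabet_words_def)
qed

lemma rot_diff:
  fixes a b :: nat
  assumes "a < 3" "b < 3" "a \<noteq> b"
  shows "(a + 2 * b) mod 3 \<in> {1, 2}"
proof -
  have "a = 0 \<or> a = 1 \<or> a = 2" "b = 0 \<or> b = 1 \<or> b = 2" using assms by linarith+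
  with assms(3) show ?thesis by (elim disjE) simp_all
qed

section \<open>Squares in products of two and three rotated words\<close>

lemma no_square_centred_right:
  assumes X: "alphabet_words n X" "separated n X" and uv: "u \<in> X" "v \<in> X"
    and ab: "a < 3" "b < 3" "a \<noteq> b"
    and L: "0 < L" "t < n" "n \<le> t + L" "t + 2 * L \<le> 2 * n"
    and eq: "\<And>j. j < L \<Longrightarrow> (rot a u @ rot b v) ! (t + j) = (rot a u @ rot b v) ! (t + L + j)"
  shows False
proof -
  define d where "d = (a + 2 * b) mod 3"
  have d: "d \<in> {1, 2}" using rot_diff ab by (simp add: d_def)
  have len: "length u = n" "length v = n" using X uv by (auto simp: alphabet_words_def)
  have swap: "v ! j = rot d u ! i" if "rot a u ! i = rot b v ! j" "i < n" "j < n" for i j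
    using rot_swap[OF X(1) uv] that by (simp add: d_def)
  define c where "c = n - t"
  have c: "1 \<le> c" "c \<le> L" "2 * L \<le> n + c" "t + c = n" "c \<le> n" using L by (auto simp: c_def)
  have left: "v ! (L - 1 - i) = rot d u ! (n - 1 - i)" if "i < c" for i
  proof -
    have i: "t + (c - 1 - i) = n - 1 - i" "t + L + (c - 1 - i) = n + (L - 1 - i)" "c - 1 - i < L"
      "n - 1 - i < n" "L - 1 - i < n"
      using that c L by linarith+
    have "rot a u ! (n - 1 - i) = rot b v ! (L - 1 - i)"
      using eq[OF i(3)] i len by (simp add: nth_append)
    then show ?thesis using swap i by blast
  qed
  show False
  proof (cases "L < n")
    case True
    have "v ! i = v ! (L + i)" if "i < L - c" for i
    proof -
      have i: "t + (c + i) = n + i" "t + L + (c + i) = n + (L + i)" "c + i < L" "i < n" "L + i < n"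
        using that c L by linarith+
      have "rot b v ! i = rot b v ! (L + i)" using eq[OF i(3)] i len by (simp add: nth_append)
      then have "rot ((b + 2 * b) mod 3) v ! i = v ! (L + i)"
        using rot_swap[OF X(1) uv(2,2) i(4,5)] by simp
      moreover have "(b + 2 * b) mod 3 = 0" by presburger
      ultimately show ?thesis using rot_id[of v] X uv by (simp add: alphabet_words_def)
    qed
    then have "\<not> (\<forall>i<c. rot d u ! (n - 1 - i) = v ! (L - 1 - i))"
      using X(2)[unfolded separated_def, rule_format, OF uv d, of c L] c True by blast
    with left show False by simp
  next
    case False
    \<comment> \<open>Only the square filling both words remains; it would equate their first
      letters, which are rotated differently.\<close>
    then have "L = n" "c = n" using c by linarith+
    then have "v ! 0 = rot d u ! 0" using left[of "n - 1"] c by simp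
    moreover have "v ! 0 = 0" "u ! 0 = 0" using X uv by (auto simp: alphabet_words_def)
    moreover have "0 < n" using L by simp
    ultimately show False using d len by auto
  qed
qed

lemma squarefree_two_rotations:
  assumes X: "alphabet_words n X" "separated n X" "separated n (rev ` X)"
    and sf: "\<And>v. v \<in> X \<Longrightarrow> squarefree_word v"
    and uv: "u \<in> X" "v \<in> X" and ab: "a < 3" "b < 3" "a \<noteq> b"
  shows "squarefree_word (rot a u @ rot b v)"
  unfolding squarefree_word_iff_nth
proof (rule notI, elim exE conjE)
  let ?W = "rot a u @ rot b v"
  fix t L assume L: "0 < L" "t + 2 * L \<le> length ?W"
    and eq: "\<forall>j<L. ?W ! (t + j) = ?W ! (t + L + j)"
  have len: "length u = n" "length v = n" using X uv by (auto simp: alphabet_words_def)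
  have tL: "t + 2 * L \<le> 2 * n" using L len by simp
  have "squarefree_word (rot a u)" "squarefree_word (rot b v)"
    using sf uv X by (auto simp: squarefree_word_rot alphabet_words_def)
  note inside = this[unfolded squarefree_word_iff_nth]
  consider "t + 2 * L \<le> n" | "n \<le> t" | "t < n" "n \<le> t + L" | "t + L < n" "n < t + 2 * L" by linarith
  then show False
  proof cases
    case 1
    have "\<forall>j<L. rot a u ! (t + j) = rot a u ! (t + L + j)"
    proof (intro allI impI)
      fix j assume j: "j < L"
      then have "t + j < n" "t + L + j < n" using 1 by linarith+
      then show "rot a u ! (t + j) = rot a u ! (t + L + j)"
        using eq[rule_format, OF j] len by (simp only: nth_append length_rot if_True)
    qed
    then show False using inside(1) 1 L len by (metis length_rot)
  next
    case 2
    have "\<forall>j<L. rot b v ! (t - n + j) = rot b v ! (t - n + L + j)"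
    proof (intro allI impI)
      fix j assume j: "j < L"
      have "t + j = n + (t - n + j)" "t + L + j = n + (t - n + L + j)" using 2 by linarith+
      then show "rot b v ! (t - n + j) = rot b v ! (t - n + L + j)"
        using eq[rule_format, OF j] len by (metis length_rot nth_append_length_plus)
    qed
    moreover have "t - n + 2 * L \<le> length (rot b v)" using 2 tL len by simp
    ultimately show False using inside(2) L by blast
  next
    case 3
    then show False using no_square_centred_right[OF X(1,2) uv ab L(1)] tL eq by blast
  next
    case 4
    \<comment> \<open>The centre lies strictly inside the left word. Reversal exchanges the words
      and brings it into the right one.\<close>
    let ?R = "rot b (rev v) @ rot a (rev u)"
    define s where "s = 2 * n - (t + 2 * L)"
    have R: "?R ! i = ?W ! (2 * n - 1 - i)" if "i < 2 * n" for i
    proof -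
      have "?R = rev ?W" by (simp add: rev_rot)
      then have "?R ! i = rev ?W ! i" by simp
      then show ?thesis using that len by (simp add: rev_nth mult_2 del: rev_append)
    qed
    have eqR: "?R ! (s + j) = ?R ! (s + L + j)" if "j < L" for j
    proof -
      have i: "s + j < 2 * n" "s + L + j < 2 * n" "2 * n - 1 - (s + j) = t + L + (L - 1 - j)"
        "2 * n - 1 - (s + L + j) = t + (L - 1 - j)" "L - 1 - j < L"
        using that 4 tL by (auto simp: s_def)
      show ?thesis using R[OF i(1)] R[OF i(2)] i(3,4) eq i(5) by metis
    qed
    have "0 < n" using 4 by simp
    note XR = alphabet_words_rev[OF X(1) this]
    show False
      by (rule no_square_centred_right[OF XR X(3) imageI[OF uv(2)] imageI[OF uv(1)] ab(2,1) ab(3)[symmetric]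
            L(1) _ _ _ eqR]) (use 4 tL in \<open>auto simp: s_def\<close>)
  qed
qed

text \<open>\<open>h\<close> and \<open>h'\<close> limit the parts of the square on the two sides of
  an overlap of length \<open>e\<close>. For a period above \<open>n\<close> these parts make up the
  \<open>n\<close> letters of the middle word; for a period below \<open>n\<close> they are the
  \<open>n - 2 * e\<close> letters that the square takes from the outer words. This is the origin of
  the assumptions \<open>small\<close> and \<open>border\<close>.\<close>

lemma squarefree_three_rotations:
  assumes X: "alphabet_words n X" "separated n X" "separated n (rev ` X)"
    and sf: "\<And>v. v \<in> X \<Longrightarrow> squarefree_word v"
    and overlap: "bounded_overlap n h X" "bounded_overlap n h' (rev ` X)"
    and small: "\<And>e. 1 \<le> e \<Longrightarrow> 2 * e \<le> n \<Longrightarrow> h e + h' e < n"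
    and border: "\<And>v e. v \<in> X \<Longrightarrow> 1 \<le> e \<Longrightarrow> 2 * e < n \<Longrightarrow> (\<forall>k<e. v ! (n - e + k) = v ! k) \<Longrightarrow>
      h e + h' e < n - 2 * e"
    and uvw: "u \<in> X" "v \<in> X" "w \<in> X"
    and abc: "a < 3" "b < 3" "c < 3" "a \<noteq> b" "b \<noteq> c"
  shows "squarefree_word (rot a u @ rot b v @ rot c w)"
  unfolding squarefree_word_iff_nth
proof (rule notI, elim exE conjE)
  let ?W = "rot a u @ rot b v @ rot c w"
  fix t L assume L: "0 < L" "t + 2 * L \<le> length ?W"
    and eq: "\<forall>j<L. ?W ! (t + j) = ?W ! (t + L + j)"
  have len: "length u = n" "length v = n" "length w = n" using X uvw by (auto simp: alphabet_words_def)
  have tL: "t + 2 * L \<le> 3 * n" using L len by simp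
  have W: "?W ! i = rot a u ! i" "?W ! (n + i) = rot b v ! i" "?W ! (2 * n + i) = rot c w ! i"
    if "i < n" for i
    using that len by (simp_all add: nth_append)
  have two: "squarefree_word (rot x p @ rot y q)"
    if "p \<in> X" "q \<in> X" "x < 3" "y < 3" "x \<noteq> y" for x y p q
    using squarefree_two_rotations[OF X sf] that by blast
  have mid: "t < n" "2 * n < t + 2 * L"
  proof -
    show "2 * n < t + 2 * L"
    proof (rule ccontr)
      assume "\<not> 2 * n < t + 2 * L"
      then have le: "t + 2 * L \<le> length (rot a u @ rot b v)" using len by simp
      have "(rot a u @ rot b v) ! i = ?W ! i" if "i < 2 * n" for i
        using that len by (simp add: nth_append)
      then have "\<forall>j<L. (rot a u @ rot b v) ! (t + j) = (rot a u @ rot b v) ! (t + L + j)"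
        using eq le len by simp
      then show False
        using two[OF uvw(1,2) abc(1,2,4)] L le unfolding squarefree_word_iff_nth by blast
    qed
    show "t < n"
    proof (rule ccontr)
      assume "\<not> t < n"
      then have t: "t = n + (t - n)" by simp
      have i: "(rot b v @ rot c w) ! i = ?W ! (n + i)" for i
        using len by (metis length_rot nth_append_length_plus)
      have "\<forall>j<L. (rot b v @ rot c w) ! (t - n + j) = (rot b v @ rot c w) ! (t - n + L + j)"
        unfolding i using eq t by (metis add.assoc)
      moreover have "t - n + 2 * L \<le> length (rot b v @ rot c w)" using len tL \<open>\<not> t < n\<close> by simp
      ultimately show False
        using two[OF uvw(2,3) abc(2,3,5)] L unfolding squarefree_word_iff_nth by blast
    qed
  qed
  have eq': "?W ! i = ?W ! (i + L)" if "t \<le> i" "i < t + L" for i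
    using eq[rule_format, of "i - t"] that by (simp add: add.commute add.left_commute)
  have letters: "set x \<subseteq> Sigma3" "x ! 0 = 0" "x ! (n - 1) = 0" if "x \<in> X" for x
    using X(1) that by (auto simp: alphabet_words_def)
  have same: "x ! i = y ! j" if "rot d x ! i = rot d y ! j" "x \<in> X" "y \<in> X" "i < n" "j < n" for x y i j d
  proof -
    have "y ! j = rot ((d + 2 * d) mod 3) x ! i" using rot_swap[OF X(1)] that by blast
    moreover have "(d + 2 * d) mod 3 = 0" by presburger
    ultimately show ?thesis using rot_id letters that by simp
  qed
  define a' c' where "a' = n - t" and "c' = t + 2 * L - 2 * n"
  consider "L = n" | "L < n" | "n < L" by linarith
  then show False
  proof cases
    case 1
    then have "?W ! n = ?W ! (2 * n)" using eq'[of n] mid tL by (simp add: mult_2)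
    then have "rot b v ! 0 = rot c w ! 0" using W(2,3)[of 0] mid by simp
    then have "b mod 3 = c mod 3" using letters uvw len mid by simp
    then show False using abc by simp
  next
    case 2
    \<comment> \<open>The middle word lies inside the square, so a period \<open>n - e\<close> gives
      it a border of length \<open>e\<close>.\<close>
    define e where "e = n - L"
    have e: "1 \<le> e" "2 * e < n" "L + e = n" using 2 mid by (auto simp: e_def)
    have "\<forall>k<e. v ! (n - e + k) = v ! k"
    proof (intro allI impI)
      fix k assume k: "k < e"
      have "?W ! (n + k) = ?W ! (n + k + L)" using k e mid by (intro eq') linarith+
      moreover have "n + k + L = n + (n - e + k)" using e by linarith
      ultimately have "rot b v ! k = rot b v ! (n - e + k)" using W(2)[of k] W(2)[of "n - e + k"] k e by simp
      then have "v ! k = v ! (n - e + k)" by (rule same) (use uvw k e in auto)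
      then show "v ! (n - e + k) = v ! k" by simp
    qed
    note fb = this
    define d where "d = (a + 2 * b) mod 3"
    define d' where "d' = (c + 2 * b) mod 3"
    have d: "d \<in> {1, 2}" "d' \<in> {1, 2}" using rot_diff abc unfolding d_def d'_def by metis+
    \<comment> \<open>\<open>bounded_overlap\<close> is used with the middle word in its first two
      roles: the border is an overlap of this word with itself, and \<open>u\<close> continues
      it.\<close>
    have "a' \<le> h e"
    proof -
      have "\<forall>i<a'. v ! (n - e - 1 - i) = rot d u ! (n - 1 - i)"
      proof (intro allI impI)
        fix i assume i: "i < a'"
        have "?W ! (n - 1 - i) = ?W ! (n - 1 - i + L)"
          using i mid tL by (intro eq') (auto simp: a'_def)
        moreover have "n - 1 - i + L = n + (n - e - 1 - i)" "n - 1 - i < n" "n - e - 1 - i < n"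
          using i mid e tL 2 by (auto simp: a'_def)
        ultimately have "rot a u ! (n - 1 - i) = rot b v ! (n - e - 1 - i)"
          using W(1)[of "n - 1 - i"] W(2)[of "n - e - 1 - i"] by simp
        then show "v ! (n - e - 1 - i) = rot d u ! (n - 1 - i)"
          unfolding d_def using \<open>n - 1 - i < n\<close> \<open>n - e - 1 - i < n\<close> by (intro rot_swap[OF X(1)] uvw)
      qed
      moreover have "a' \<le> n - e" using mid e tL by (auto simp: a'_def)
      ultimately show ?thesis
        using overlap(1) uvw(1,2) d(1) e fb unfolding bounded_overlap_def by (metis less_imp_le)
    qed
    moreover have "c' \<le> h' e"
    proof -
      have "\<forall>k<e. rev v ! (n - e + k) = rev v ! k"
      proof (intro allI impI)
        fix k assume k: "k < e"
        have "v ! (e - 1 - k) = v ! (n - e + (e - 1 - k))"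
          using fb[rule_format, of "e - 1 - k"] k by simp
        moreover have "n - e + (e - 1 - k) = n - Suc k" "n - Suc (n - e + k) = e - 1 - k" using k e by linarith+
        ultimately show "rev v ! (n - e + k) = rev v ! k" using k e len by (simp add: rev_nth)
      qed
      moreover have "\<forall>i<c'. rev v ! (n - e - 1 - i) = rot d' (rev w) ! (n - 1 - i)"
      proof (intro allI impI)
        fix i assume i: "i < c'"
        have "?W ! (n + (e + i)) = ?W ! (n + (e + i) + L)"
          using i mid e by (intro eq') (auto simp: c'_def)
        moreover have k: "n + (e + i) + L = 2 * n + i" "i < n" "e + i < n" using i e tL mid by (auto simp: c'_def)
        ultimately have "rot b v ! (e + i) = rot c w ! i" using W(2,3) by metis
        then have "v ! (e + i) = rot d' w ! i"
          unfolding d'_def using k by (intro rot_swap[OF X(1)] uvw) simp_all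
        moreover have "n - Suc (n - e - 1 - i) = e + i" "n - Suc (n - 1 - i) = i" using k by linarith+
        ultimately show "rev v ! (n - e - 1 - i) = rot d' (rev w) ! (n - 1 - i)"
          using k len by (simp add: rev_nth)
      qed
      moreover have "c' \<le> n - e" using mid e tL by (auto simp: c'_def)
      ultimately show ?thesis
        using overlap(2) imageI[OF uvw(2), of rev] imageI[OF uvw(3), of rev] d(2) e
        unfolding bounded_overlap_def by (metis less_imp_le)
    qed
    moreover have "h e + h' e < n - 2 * e" using border uvw(2) e fb by blast
    moreover have "a' + c' = n - 2 * e" using mid e by (auto simp: a'_def c'_def)
    ultimately show False by linarith
  next
    case 3
    define e where "e = L - n"
    have e: "1 \<le> e" "L = n + e" using 3 by (auto simp: e_def)
    have tn: "t + L < 2 * n" "n < t + L" using mid tL e by linarith+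
    have e2: "2 * e \<le> n" using tn mid tL e by linarith
    have fb: "\<forall>k<e. rot a u ! (n - e + k) = rot c w ! k"
    proof (intro allI impI)
      fix k assume k: "k < e"
      have "?W ! (n - e + k) = ?W ! (n - e + k + L)" using k tn e e2 mid tL by (intro eq') linarith+
      moreover have "n - e + k + L = 2 * n + k" "n - e + k < n" "k < n" using k e e2 by linarith+
      ultimately show "rot a u ! (n - e + k) = rot c w ! k" using W(1,3) by metis
    qed
    have ac: "a = c"
    proof (rule ccontr)
      assume "a \<noteq> c"
      then have "squarefree_word (rot a u @ rot c w)" using two uvw abc by blast
      moreover have "\<forall>j<e. (rot a u @ rot c w) ! (n - e + j) = (rot a u @ rot c w) ! (n - e + e + j)"
      proof (intro allI impI)
        fix j assume j: "j < e"
        then have "n - e + e + j = n + j" "n - e + j < n" using e2 by linarith+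
        then show "(rot a u @ rot c w) ! (n - e + j) = (rot a u @ rot c w) ! (n - e + e + j)"
          using fb j len by (simp add: nth_append)
      qed
      moreover have "n - e + 2 * e \<le> length (rot a u @ rot c w)" using e2 len by simp
      ultimately show False unfolding squarefree_word_iff_nth using e(1) by (metis less_le_trans zero_less_one)
    qed
    have fb': "u ! (n - e + k) = w ! k" if "k < e" for k
      by (rule same[of c]) (use fb ac that uvw e2 in auto)
    \<comment> \<open>The centre of the square cuts the middle word into a prefix of
      \<open>g\<close> and a suffix of \<open>y\<close> letters.\<close>
    define y g where "y = 2 * n - t - L" and "g = t + L - n"
    have yg: "y + g = n" "y \<le> n - e" "g \<le> n - e" using tn mid tL e by (auto simp: y_def g_def)
    define d where "d = (b + 2 * a) mod 3"
    have d: "d \<in> {1, 2}" using rot_diff[of b a] abc unfolding d_def by metis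
    have "y \<le> h e"
    proof -
      have "\<forall>i<y. u ! (n - e - 1 - i) = rot d v ! (n - 1 - i)"
      proof (intro allI impI)
        fix i assume i: "i < y"
        have "?W ! (n - e - 1 - i) = ?W ! (n - e - 1 - i + L)"
          using i tn mid e e2 tL by (intro eq') (auto simp: y_def)
        moreover have k: "n - e - 1 - i + L = n + (n - 1 - i)" "n - 1 - i < n" "n - e - 1 - i < n"
          using i yg e e2 by linarith+
        ultimately have "rot b v ! (n - 1 - i) = rot a u ! (n - e - 1 - i)" using W(1,2) by metis
        then show "u ! (n - e - 1 - i) = rot d v ! (n - 1 - i)"
          unfolding d_def using k by (intro rot_swap[OF X(1)] uvw) simp_all
      qed
      then show ?thesis
        using overlap(1) uvw d e(1) e2 fb' yg(2) unfolding bounded_overlap_def by metis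
    qed
    moreover have "g \<le> h' e"
    proof -
      have "\<forall>k<e. rev w ! (n - e + k) = rev u ! k"
      proof (intro allI impI)
        fix k assume k: "k < e"
        have "u ! (n - e + (e - 1 - k)) = w ! (e - 1 - k)" by (rule fb') (use k in simp)
        moreover have "n - e + (e - 1 - k) = n - Suc k" "n - Suc (n - e + k) = e - 1 - k" "k < n" "n - e + k < n"
          using k e2 by linarith+
        ultimately show "rev w ! (n - e + k) = rev u ! k" using len by (simp add: rev_nth)
      qed
      moreover have "\<forall>i<g. rev w ! (n - e - 1 - i) = rot d (rev v) ! (n - 1 - i)"
      proof (intro allI impI)
        fix i assume i: "i < g"
        have "?W ! (n + i) = ?W ! (n + i + L)" using i tn mid by (intro eq') (auto simp: g_def)
        moreover have k: "n + i + L = 2 * n + (e + i)" "i < n" "e + i < n" using i yg e e2 by linarith+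
        ultimately have "rot b v ! i = rot a w ! (e + i)" using W(2,3) ac by metis
        then have "w ! (e + i) = rot d v ! i"
          unfolding d_def using k by (intro rot_swap[OF X(1)] uvw) simp_all
        moreover have "n - Suc (n - e - 1 - i) = e + i" "n - Suc (n - 1 - i) = i" using k by linarith+
        ultimately show "rev w ! (n - e - 1 - i) = rot d (rev v) ! (n - 1 - i)"
          using k len by (simp add: rev_nth)
      qed
      ultimately show ?thesis
        using overlap(2) imageI[OF uvw(1), of rev] imageI[OF uvw(2), of rev] imageI[OF uvw(3), of rev]
          d e(1) e2 yg(3) unfolding bounded_overlap_def by metis
    qed
    moreover have "h e + h' e < n" using small e(1) e2 by blast
    ultimately show False using yg(1) by linarith
  qed
qed

section \<open>Checking the conditions by rewriting\<close>

text \<open>\<open>Leaf\<close> is the empty set and \<open>Node Leaf Leaf Leaf\<close> contains the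
  empty word. Only prefixes are looked up, so that no node needs an end mark.\<close>

datatype trie = Leaf | Node trie trie trie

fun insert_word :: "nat list \<Rightarrow> trie \<Rightarrow> trie" where
  "insert_word [] Leaf = Node Leaf Leaf Leaf"
| "insert_word [] (Node a b c) = Node a b c"
| "insert_word (x # w) Leaf = (if x = 0 then Node (insert_word w Leaf) Leaf Leaf
     else if x = 1 then Node Leaf (insert_word w Leaf) Leaf else Node Leaf Leaf (insert_word w Leaf))"
| "insert_word (x # w) (Node a b c) = (if x = 0 then Node (insert_word w a) b c
     else if x = 1 then Node a (insert_word w b) c else Node a b (insert_word w c))"

text \<open>The query is rotated during the descent, so one trie serves all rotations of the
  words.\<close>

fun has_path :: "nat \<Rightarrow> nat list \<Rightarrow> trie \<Rightarrow> bool" where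
  "has_path d q Leaf \<longleftrightarrow> False"
| "has_path d [] (Node a b c) \<longleftrightarrow> True"
| "has_path d (x # q) (Node a b c) \<longleftrightarrow> has_path d q
     (if (x + d) mod 3 = 0 then a else if (x + d) mod 3 = 1 then b else c)"

primrec trie_of :: "nat list list \<Rightarrow> trie" where
  "trie_of [] = Leaf"
| "trie_of (w # ws) = insert_word w (trie_of ws)"

lemma has_path_rot: "has_path d q t \<longleftrightarrow> has_path 0 (rot d q) t"
  by (induction d q t rule: has_path.induct) (simp_all add: rot_def)

lemma has_path_insert_word: "set w \<subseteq> Sigma3 \<Longrightarrow> has_path 0 (take j w) (insert_word w t)"
proof (induction w t arbitrary: j rule: insert_word.induct)
  case (3 x w)
  then show ?case by (cases j) (auto simp: Sigma3_def)
next
  case (4 x w a b c)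
  then show ?case by (cases j) (auto simp: Sigma3_def)
qed simp_all

lemma has_path_mono: "has_path 0 q t \<Longrightarrow> has_path 0 q (insert_word w t)"
proof (induction w t arbitrary: q rule: insert_word.induct)
  case (4 x w a b c)
  then show ?case by (cases q) auto
qed simp_all

lemma has_path_trie_of:
  assumes "w \<in> set ws" "set w \<subseteq> Sigma3"
  shows "has_path 0 (take j w) (trie_of ws)"
  using assms by (induction ws) (auto intro: has_path_insert_word has_path_mono)

lemma has_path_trie_of_rot:
  assumes "w \<in> set ws" "set w \<subseteq> Sigma3" "c + d = 3"
  shows "has_path c (take j (rot d w)) (trie_of ws)"
proof -
  have "rot c (take j (rot d w)) = take j (rot c (rot d w))" by (simp add: rot_def take_map)
  also have "rot c (rot d w) = w"
    unfolding rot_rot assms(3) using assms(2) by (auto simp: rot_def Sigma3_def intro!: map_idI)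
  finally show ?thesis using has_path_trie_of[OF assms(1,2)] has_path_rot by metis
qed

section \<open>Squares and borders by comparing a word with its suffixes\<close>

text \<open>Only the lengths of the lists \<open>k\<close> and \<open>l\<close> matter below: they are unary counters.\<close>

fun aperiodic_run :: "'a list \<Rightarrow> 'a list \<Rightarrow> 'b list \<Rightarrow> 'b list \<Rightarrow> bool" where
  "aperiodic_run x y [] l \<longleftrightarrow> False"
| "aperiodic_run (a # x) (b # y) (c # k) l \<longleftrightarrow> aperiodic_run x y (if a = b then k else l) l"
| "aperiodic_run [] y (c # k) l \<longleftrightarrow> True"
| "aperiodic_run x [] (c # k) l \<longleftrightarrow> True"

text \<open>A square of period \<open>L\<close> consists of \<open>L\<close> consecutive agreements
  between \<open>v\<close> and its suffix from position \<open>L\<close>. The reversed prefix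
  \<open>rl\<close> has \<open>L\<close> letters and serves as the counter. A run completed by the
  last letter counts, because \<open>aperiodic_run\<close> tests for the empty counter
  first.\<close>

fun aperiodic :: "'a list \<Rightarrow> 'a list \<Rightarrow> 'a list \<Rightarrow> bool" where
  "aperiodic v rl [] \<longleftrightarrow> True"
| "aperiodic v rl (y # r) \<longleftrightarrow> aperiodic_run v (y # r) rl rl \<and> aperiodic v (y # rl) r"

text \<open>The second conclusion, on runs starting anywhere, is the one applied. The first, on the
  run in progress, carries the induction: since \<open>k\<close> is not longer than
  \<open>l\<close>, a full run starting here would also complete the current one.\<close>

lemma aperiodic_runD:
  assumes "aperiodic_run x y k l" "length k \<le> length l"
  shows "\<not> (\<forall>j<length k. j < length x \<and> j < length y \<and> x ! j = y ! j)"
    and "\<not> (\<forall>j<length l. i + j < length x \<and> i + j < length y \<and> x ! (i + j) = y ! (i + j))"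
proof -
  have "\<not> (\<forall>j<length k. j < length x \<and> j < length y \<and> x ! j = y ! j) \<and>
    (\<forall>i. \<not> (\<forall>j<length l. i + j < length x \<and> i + j < length y \<and> x ! (i + j) = y ! (i + j)))"
    using assms
  proof (induction x y k l rule: aperiodic_run.induct)
    case (2 a x b y c k l)
    let ?k = "if a = b then k else l"
    have IH: "\<not> (\<forall>j<length ?k. j < length x \<and> j < length y \<and> x ! j = y ! j)"
      "\<not> (\<forall>j<length l. i + j < length x \<and> i + j < length y \<and> x ! (i + j) = y ! (i + j))" for i
      using 2 by auto
    have hd: "\<not> (\<forall>j<length (c # k). j < length (a # x) \<and> j < length (b # y) \<and> (a # x) ! j = (b # y) ! j)"
    proof
      assume *: "\<forall>j<length (c # k). j < length (a # x) \<and> j < length (b # y) \<and> (a # x) ! j = (b # y) ! j"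
      then have "a = b" by force
      moreover have "\<forall>j<length k. j < length x \<and> j < length y \<and> x ! j = y ! j"
      proof (intro allI impI)
        fix j assume "j < length k"
        then show "j < length x \<and> j < length y \<and> x ! j = y ! j" using *[rule_format, of "Suc j"] by simp
      qed
      ultimately show False using IH(1) by simp
    qed
    have "\<not> (\<forall>j<length l. i + j < length (a # x) \<and> i + j < length (b # y) \<and>
        (a # x) ! (i + j) = (b # y) ! (i + j))" for i
    proof (cases i)
      case 0
      then show ?thesis using hd 2(3) by (auto dest: less_le_trans)
    next
      case (Suc i')
      then show ?thesis using IH(2)[of i'] by simp
    qed
    with hd show ?case by blast
  qed (auto simp: Suc_le_eq)
  then show "\<not> (\<forall>j<length k. j < length x \<and> j < length y \<and> x ! j = y ! j)"
    "\<not> (\<forall>j<length l. i + j < length x \<and> i + j < length y \<and> x ! (i + j) = y ! (i + j))" by blast+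
qed

lemma aperiodic_drop:
  "aperiodic v rl r \<Longrightarrow> i < length r \<Longrightarrow>
     aperiodic_run v (drop i r) (rev (take i r) @ rl) (rev (take i r) @ rl)"
proof (induction v rl r arbitrary: i rule: aperiodic.induct)
  case (2 v rl y r)
  then show ?case by (cases i) auto
qed simp

lemma squarefree_word_aperiodic:
  assumes "aperiodic v (take 1 v) (drop 1 v)"
  shows "squarefree_word v"
  unfolding squarefree_word_iff_nth
proof (rule notI, elim exE conjE)
  fix t L assume L: "0 < L" "t + 2 * L \<le> length v" and eq: "\<forall>j<L. v ! (t + j) = v ! (t + L + j)"
  have "rev (take (L - 1) (drop 1 v)) @ take 1 v = rev (take L v)"
    using L by (cases v; cases L) auto
  then have "aperiodic_run v (drop L v) (rev (take L v)) (rev (take L v))"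
    using aperiodic_drop[OF assms, of "L - 1"] L by simp
  from aperiodic_runD(2)[OF this, of t] show False
    using L eq by (auto simp: algebra_simps)
qed

text \<open>One element of \<open>k\<close> is dropped per letter of the common prefix. If
  \<open>k\<close> has length \<open>L\<close> and \<open>r\<close> is the suffix from position
  \<open>L\<close>, the rest measures the factor between the end of the common prefix and
  \<open>L\<close>, which is the factor to be looked up.\<close>

fun residue :: "'a list \<Rightarrow> 'a list \<Rightarrow> 'b list \<Rightarrow> 'b list" where
  "residue (x # v) (y # r) (z # k) = (if x = y then residue v r k else z # k)"
| "residue v r k = k"

lemma length_residue:
  assumes "\<forall>i<j. v ! i = r ! i" "j \<le> length v" "j \<le> length r"
  shows "length (residue v r k) \<le> length k - j"
  using assms
proof (induction v r k arbitrary: j rule: residue.induct)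
  case (1 x v y r z k)
  show ?case
  proof (cases j)
    case (Suc i)
    have "x = y" "\<forall>k<i. v ! k = r ! k" using 1(2) Suc by (force, auto)
    then show ?thesis using 1(1)[of i] 1(3,4) Suc by simp
  next
    case 0
    then show ?thesis using 1(1)[of 0] by (cases "x = y") auto
  qed
qed auto

fun differs :: "'a list \<Rightarrow> 'a list \<Rightarrow> 'b list \<Rightarrow> bool" where
  "differs (x # p) (y # r) (c # k) \<longleftrightarrow> x \<noteq> y \<or> differs p r k"
| "differs p r k \<longleftrightarrow> False"

lemma differs_nth: "differs p r k \<Longrightarrow> \<exists>i<length k. i < length p \<and> i < length r \<and> p ! i \<noteq> r ! i"
proof (induction p r k rule: differs.induct)
  case (1 x p y r c k)
  then show ?case by (cases "x = y") (auto intro: exI[of _ 0] exI[of _ "Suc _"])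
qed simp_all

text \<open>Suffixes of fewer than six letters are exempt: the stem forces borders of lengths 1 and
  5.\<close>

fun borderless :: "'a list \<Rightarrow> 'a list \<Rightarrow> bool" where
  "borderless v (a # b # c # d # e # f # r) \<longleftrightarrow>
     differs v (a # b # c # d # e # f # r) (a # b # c # d # e # f # r) \<and> borderless v (b # c # d # e # f # r)"
| "borderless v r \<longleftrightarrow> True"

lemma borderless_drop:
  "borderless v r \<Longrightarrow> i + 6 \<le> length r \<Longrightarrow> differs v (drop i r) (drop i r)"
proof (induction v r arbitrary: i rule: borderless.induct)
  case (1 v a b c d e f r)
  then show ?case by (cases i) auto
qed simp_all

section \<open>The lookups generated by a word\<close>

fun collect :: "('a list \<Rightarrow> 'a list \<Rightarrow> 'b list) \<Rightarrow> 'a list \<Rightarrow> 'a list \<Rightarrow> 'b list" where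
  "collect f rl [] = []"
| "collect f rl (y # r) = f rl (y # r) @ collect f (y # rl) r"

lemma set_collect:
  "i < length r \<Longrightarrow> set (f (rev (take i r) @ rl) (drop i r)) \<subseteq> set (collect f rl r)"
proof (induction f rl r arbitrary: i rule: collect.induct)
  case (2 f rl y r)
  show ?case
  proof (cases i)
    case (Suc j)
    then show ?thesis using 2(1)[of j] 2(2) by auto
  qed auto
qed simp

lemma set_collect_split:
  assumes "1 \<le> L" "L < length v"
  shows "set (f (rev (take L v)) (drop L v)) \<subseteq> set (collect f (take 1 v) (drop 1 v))"
proof (cases v)
  case (Cons x w)
  obtain i where "L = Suc i" using assms by (cases L) auto
  then show ?thesis using set_collect[of i w f "[x]"] assms Cons by simp
qed (use assms in simp)

text \<open>The words start with it and end with its mirror image, so reversal preserves this shape.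
  Since \<open>[0, 1, 2, 1, 0]\<close> is a palindrome, the end of one word and the start of another
  always overlap in 1 and in 5 letters, but never in 2, 3, 4 or 6.\<close>

abbreviation stem :: "nat list" where "stem \<equiv> [0, 1, 2, 1, 0, 2]"

text \<open>Most factors already disagree with both rotations of the common stem, so that few of them have
  to be looked up. The Boolean argument of the two \<open>emit\<close> functions decides before the
  simplifier, which normalises arguments first, computes the factor.\<close>

definition emit_pair :: "bool \<Rightarrow> nat list \<Rightarrow> nat list \<Rightarrow> nat list list" where
  "emit_pair skip rl k = (if skip then [] else [take (length k) rl])"

definition query_pair :: "nat list \<Rightarrow> nat list \<Rightarrow> nat list list" where
  "query_pair rl k = emit_pair (differs [1, 2, 0, 2, 1, 0] rl k \<and> differs [2, 0, 1, 0, 2, 1] rl k) rl k"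

definition pair_queries :: "nat list \<Rightarrow> nat list \<Rightarrow> nat list \<Rightarrow> nat list list" where
  "pair_queries v rl r = query_pair rl (residue v r rl)"

text \<open>One limit for each kind of overlap left by the stem: a single letter, five letters, and
  long ones.\<close>

fun reach :: "nat \<times> nat \<times> nat \<Rightarrow> nat \<Rightarrow> nat" where
  "reach (a, b, c) e = (if e = 1 then a else if e < 6 then b else c)"

definition emit_overlap :: "bool \<Rightarrow> nat \<times> nat \<times> nat \<Rightarrow> nat list \<Rightarrow> nat list \<Rightarrow> (nat list \<times> nat list) list" where
  "emit_overlap skip p rl r = (if skip then [] else [(r, take (reach p (length r)) rl)])"

definition overlap_queries :: "nat \<times> nat \<times> nat \<Rightarrow> nat list \<Rightarrow> nat list \<Rightarrow> (nat list \<times> nat list) list" where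
  "overlap_queries p rl r = emit_overlap (differs stem r r) p rl r"

definition absent :: "trie \<Rightarrow> nat list \<Rightarrow> bool" where
  "absent T q \<longleftrightarrow> \<not> has_path 1 q T \<and> \<not> has_path 2 q T"

text \<open>\<open>r\<close> is looked up unrotated as the start of a word, \<open>q\<close> in the
  reversed words as the end of a rotated one.\<close>

fun overlap_ok :: "trie \<Rightarrow> trie \<Rightarrow> nat list \<times> nat list \<Rightarrow> bool" where
  "overlap_ok S T (r, q) \<longleftrightarrow> \<not> has_path 0 r S \<or> absent T q"

definition certified :: "nat \<times> nat \<times> nat \<Rightarrow> trie \<Rightarrow> trie \<Rightarrow> nat list \<Rightarrow> bool" where
  "certified p S T v \<longleftrightarrow>
     list_all (absent T) (collect (pair_queries v) (take 1 v) (drop 1 v)) \<and>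
     list_all (overlap_ok S T) (collect (overlap_queries p) (take 1 v) (drop 1 v))"

definition all_certified :: "nat \<times> nat \<times> nat \<Rightarrow> nat list list \<Rightarrow> bool" where
  "all_certified p ws = list_all (certified p (trie_of ws) (trie_of (map rev ws))) ws"

section \<open>From failed lookups to the conditions on pairs\<close>

context
  fixes n :: nat and ws :: "nat list list" and p :: "nat \<times> nat \<times> nat"
  assumes words: "alphabet_words n (set ws)" and cert: "all_certified p ws"
    and stems: "\<And>v. v \<in> set ws \<Longrightarrow> take 6 v = stem \<and> take 6 (rev v) = stem"
begin

lemma stem_nth:
  assumes "v \<in> set ws" "i < 6"
  shows "i < length v" "v ! i = stem ! i" "rev v ! i = stem ! i"
proof -
  have t: "take 6 v = stem" "take 6 (rev v) = stem" using stems assms by auto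
  have "length (take 6 v) = 6" unfolding t by simp
  then show "i < length v" using assms by simp
  show "v ! i = stem ! i" using arg_cong[OF t(1), of "\<lambda>x. x ! i"] assms(2) by simp
  show "rev v ! i = stem ! i" using arg_cong[OF t(2), of "\<lambda>x. x ! i"] assms(2) by simp
qed

lemma not_absent:
  assumes "v \<in> set ws" "d \<in> {1, 2}"
  shows "\<not> absent (trie_of (map rev ws)) (take j (rot d (rev v)))"
proof -
  have "rev v \<in> set (map rev ws)" "set (rev v) \<subseteq> Sigma3"
    using assms words by (auto simp: alphabet_words_def)
  from has_path_trie_of_rot[OF this, of "3 - d" d j] assms(2) show ?thesis
    by (auto simp: absent_def numeral_3_eq_3 numeral_2_eq_2)
qed

lemma take_rev_eq_rot:
  assumes "u \<in> set ws" "v \<in> set ws" "L \<le> n" "m \<le> L"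
    and "\<forall>i<m. v ! (L - 1 - i) = rot d u ! (n - 1 - i)"
  shows "take m (rev (take L v)) = take m (rot d (rev u))"
proof (rule nth_equalityI)
  have len: "length u = n" "length v = n" using assms words by (auto simp: alphabet_words_def)
  then show "length (take m (rev (take L v))) = length (take m (rot d (rev u)))" using assms by simp
  fix i assume "i < length (take m (rev (take L v)))"
  then show "take m (rev (take L v)) ! i = take m (rot d (rev u)) ! i"
    using assms len by (simp add: rev_nth rev_rot[symmetric])
qed

text \<open>Among all squares of period \<open>L\<close>, the longest common prefix demands the
  shortest factor. Its length is at most \<open>a\<close>, so a forbidden pair of words would make
  the lookup of this factor succeed.\<close>

lemma separated_certified: "separated n (set ws)"
  unfolding separated_def
proof (intro ballI allI impI notI, elim conjE)
  fix u v d a L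
  assume uv: "u \<in> set ws" "v \<in> set ws" and d: "d \<in> {1, 2 :: nat}"
    and a: "1 \<le> a" "a \<le> L" "L < n" "2 * L \<le> n + a"
    and per: "\<forall>i<L - a. v ! i = v ! (L + i)" and "\<forall>i<a. rot d u ! (n - 1 - i) = v ! (L - 1 - i)"
  then have eq: "take a (rev (take L v)) = take a (rot d (rev u))"
    using take_rev_eq_rot[of u v L a d] by simp
  have len: "length u = n" "length v = n" using uv words by (auto simp: alphabet_words_def)
  define rl k where "rl = rev (take L v)" and "k = residue v (drop L v) rl"
  have "length k \<le> length rl - (L - a)"
    unfolding k_def using per a len by (intro length_residue) auto
  then have k: "length k \<le> a" using a len by (simp add: rl_def)
  have eqi: "rl ! i = rot d (rev u) ! i" if "i < length k" for i
    using arg_cong[OF eq, of "\<lambda>x. x ! i"] that k by (simp add: rl_def)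
  have stem_d: "(if d = 1 then [1, 2, 0, 2, 1, 0] else [2, 0, 1, 0, 2, 1]) = rot d stem"
    using d by (auto simp: rot_def)
  \<comment> \<open>The lookup is not skipped: the first \<open>length k\<close> letters of
    \<open>rl\<close> come from the rotated reversal of \<open>u\<close>, which starts with the
    rotated stem.\<close>
  have "\<not> differs (rot d stem) rl k"
  proof
    assume "differs (rot d stem) rl k"
    from differs_nth[OF this] obtain i
      where i: "i < length k" "i < length (rot d stem)" "rot d stem ! i \<noteq> rl ! i" by blast
    then have "i < 6" by simp
    have "rot d (rev u) ! i = (rev u ! i + d) mod 3"
      using stem_nth(1)[OF uv(1) \<open>i < 6\<close>] by simp
    also have "\<dots> = rot d stem ! i"
      using i(2) by (simp only: stem_nth(3)[OF uv(1) \<open>i < 6\<close>] nth_rot length_rot)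
    finally have "rot d (rev u) ! i = rot d stem ! i" .
    with i eqi show False by simp
  qed
  then have "take (length k) rl \<in> set (pair_queries v rl (drop L v))"
    using d stem_d by (auto simp: pair_queries_def query_pair_def emit_pair_def k_def split: if_splits)
  then have "take (length k) rl \<in> set (collect (pair_queries v) (take 1 v) (drop 1 v))"
    using set_collect_split[of L v "pair_queries v"] a len unfolding rl_def by auto
  then have "absent (trie_of (map rev ws)) (take (length k) rl)"
    using cert uv(2) by (auto simp: all_certified_def certified_def list_all_iff)
  moreover have "take (length k) rl = take (length k) (rot d (rev u))"
    using arg_cong[OF eq, of "take (length k)"] k by (simp add: rl_def min_absorb1)
  ultimately show False using not_absent[OF uv(1) d] by simp
qed

text \<open>The factor looked up has one letter more than the bound admits. Any longer agreement
  contains it, so one failed lookup excludes them all.\<close>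

lemma bounded_overlap_certified: "bounded_overlap n (\<lambda>e. reach p e - 1) (set ws)"
  unfolding bounded_overlap_def
proof (intro ballI allI impI, elim conjE)
  fix u w v d e y
  assume uwv: "u \<in> set ws" "w \<in> set ws" "v \<in> set ws" and d: "d \<in> {1, 2 :: nat}"
    and e: "1 \<le> e" "2 * e \<le> n" "y \<le> n - e"
    and border: "\<forall>k<e. u ! (n - e + k) = w ! k"
    and eq: "\<forall>i<y. u ! (n - e - 1 - i) = rot d v ! (n - 1 - i)"
  show "y \<le> reach p e - 1"
  proof (rule ccontr)
    assume "\<not> y \<le> reach p e - 1"
    then have y: "reach p e \<le> y" by simp
    have len: "length u = n" "length w = n" using uwv words by (auto simp: alphabet_words_def)
    define rl r where "rl = rev (take (n - e) u)" and "r = drop (n - e) u"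
    have r: "r = take e w" unfolding r_def using border len e by (intro nth_equalityI) auto
    have ne: "1 \<le> n - e" "n - e < length u" using e len by linarith+
    have lr: "length r = e" using len e by (simp add: r_def)
    have "\<not> differs stem r r"
    proof
      assume "differs stem r r"
      from differs_nth[OF this] obtain i where i: "i < length r" "i < length stem" "stem ! i \<noteq> r ! i" by blast
      then have "i < 6" "i < e" using lr by simp_all
      with i(3) show False using stem_nth[OF uwv(2), of i] r by simp
    qed
    then have "(r, take (reach p e) rl) \<in> set (overlap_queries p rl r)"
      by (simp add: overlap_queries_def emit_overlap_def lr)
    then have "(r, take (reach p e) rl) \<in> set (collect (overlap_queries p) (take 1 u) (drop 1 u))"
      using set_collect_split[OF ne, of "overlap_queries p"] unfolding rl_def r_def by blast
    then have "overlap_ok (trie_of ws) (trie_of (map rev ws)) (r, take (reach p e) rl)"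
      using cert uwv(1) unfolding all_certified_def certified_def list_all_iff by blast
    moreover have "has_path 0 r (trie_of ws)"
      unfolding r using has_path_trie_of uwv(2) words by (auto simp: alphabet_words_def)
    moreover have "take (reach p e) rl = take (reach p e) (rot d (rev v))"
      unfolding rl_def using take_rev_eq_rot[OF uwv(3,1), of "n - e" "reach p e" d] eq y e by simp
    ultimately show False using not_absent[OF uwv(3) d] by simp
  qed
qed

end

section \<open>The explicit words\<close>

text \<open>Adjacent letters of a squarefree word differ, which leaves two choices per step; a word
  of length 54 with known first letter takes 53 binary digits.\<close>

fun walk :: "nat \<Rightarrow> nat \<Rightarrow> nat \<Rightarrow> nat list" where
  "walk 0 x c = []"
| "walk (Suc k) x c = x # walk k ((x + 1 + c mod 2) mod 3) (c div 2)"

lemma length_walk [simp]: "length (walk k x c) = k"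
  by (induction k arbitrary: x c) simp_all

lemma set_walk: "x < 3 \<Longrightarrow> set (walk k x c) \<subseteq> Sigma3"
proof (induction k arbitrary: x c)
  case (Suc k)
  have "set (walk k ((x + 1 + c mod 2) mod 3) (c div 2)) \<subseteq> Sigma3" by (rule Suc.IH) simp
  then show ?case using Suc.prems by (auto simp: Sigma3_def)
qed simp

text \<open>The \<open>j\<close>-th binary digit of a code says whether the letter at position \<open>j + 1\<close> exceeds the one
  at position \<open>j\<close> by 1 or by 2 modulo 3. The words were found by a local search for a large
  independent set in the graph of incompatible words.\<close>

definition codes :: "nat list" where
  "codes = [
  6862632912144284, 6862632098449308, 6889415514507164, 6879382470903708, 6889409072056220,
  6865108147095452, 6879539237210012, 6863046562793372, 6889415715833756, 6882681039341468,
  6862941369649052, 6863044448864156, 6879582220437404, 6879514574702492, 6862893051266972,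
  6888178865915804, 6865089121732508, 6862666760177564, 6882732847384476, 6879539504596892,
  6879513466357660, 6862634244884380, 6888386868791196, 6888178562877340, 6865088818694044,
  6862666457139100, 6889329614112668, 6862628431579036, 6862655006689180, 6862663999276956,
  6862941363685276, 6863044442900380, 6862893045303196, 6888387971172252, 6862634541959068,
  6862892239996828, 6888178859952028, 6865089115768732, 6862666754213788, 6889329911187356,
  6889408965429148, 6889280116410268, 6882683046643612, 6888197784651676, 6865108040468380,
  6879539130582940, 6863046456166300, 6888374901720988, 6879514921060252, 6879513511774108,
  6862634290300828, 6865088864110492, 6889410190165916, 6879591894927260, 6862632132331420,
  6879382504785820, 6889409105938332, 6889278377871260, 6882681308104604, 6862628105799580,
  6888181013727132, 6865091269543836, 6879402100574108, 6879513379653532, 6862891856218012,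
  6888375507797916, 6879583709743004, 6888181831616412, 6862632144914332, 6889415560972188,
  6879382517368732, 6889409118521244, 6865108193560476, 6879539283675036, 6879514570311580,
  6862893046876060, 6862634543531932, 6862892241569692, 6889280524830620, 6882683455063964,
  6879513500764060, 6888178597283740, 6865088853100444, 6862666491545500, 6889329648519068,
  6889281330136988, 6889278276683676, 6882681206917020, 6862941537224604, 6879537290856348,
  6863044616439708, 6889415791134620, 6879382747531164, 6889280499664796, 6882683429898140,
  6888198167906204, 6865108423722908, 6862942149592988, 6888196557293468, 6879537903224732,
  6862628616980380, 6882683417388956, 6865108411213724, 6879539501328284, 6863046826911644,
  6862942137083804, 6888196544784284, 6879537890715548, 6863045216298908, 6862628604471196,
  6864930706941852, 6862634241615772, 6888386865522588, 6865088815425436, 6889329610844060,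
  6879513362425756, 6862891838990236, 6888386764859292, 6879591745578908, 6862628101154716,
  6888181009082268, 6865091264898972, 6879402095929244, 6862663983425436, 6889278285146012,
  6882681215379356, 6879537299318684, 6863044624902044, 6862628013074332, 6864930115544988,
  6862634522634140, 6862892220671900, 6865101981345692, 6879539504474012, 6879537893861276,
  6863045219444636, 6862628607616924, 6879513466234780, 6862634244761500, 6888386868668316,
  6862666457016220, 6889329613989788, 6882732544223132, 6889278351206300, 6882681281439644,
  6862628079134620, 6864930181605276, 6888374954223516, 6889408967600028, 6889280118581148,
  6882683048814492, 6888197786822556, 6865108042639260, 6879539132753820, 6863046458337180,
  6865090879547292, 6879401710577564, 6879582099203996, 6879395658196892, 6889415816898460,
  6879382773295004, 6889280525428636, 6882683455661980, 6879513501362076, 6865088853698460,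
  6862666492143516, 6889329649117084, 6889410179753884, 6879400389371804, 6862667196786588,
  6882733283993500, 6889278277281692, 6882681207515036, 6862941537822620, 6879537291454364,
  6864930107680668, 6889278075955100, 6882681006188444, 6862941336496028, 6863044415711132,
  6879582187284380, 6879396161513372, 6862632904157084, 6889415816799132, 6879382773195676,
  6889280525329308, 6882683455562652, 6888198193570716, 6879539539501980, 6863046865085340,
  6888178597782428, 6865088853599132, 6862666492044188, 6889329649017756, 6889410179654556,
  6889281330635676, 6882681006089116, 6862941336396700, 6863044415611804, 6879582187185052,
  6879396161414044, 6862632904057756, 6889278119895964, 6882681050129308, 6863044459651996,
  6879401842598812, 6879514585490332, 6862893062054812, 6888387987923868, 6879514988143516,
  6879513360753564, 6862891837318044, 6888386763187100, 6879591743906716, 6882681301787548,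
  6862941632095132, 6865091263226780, 6889409988027292, 6879591692788636, 6879401841812380,
  6879582230438812, 6879514584703900, 6862893061268380, 6888387987137436, 6882683062608796,
  6888197800616860, 6865108056433564, 6879539146548124, 6863046472131484, 6879582104609692,
  6889418653459356, 6862892935439260, 6864930528322460, 6888375412614044, 6879583614559132,
  6879395654165404, 6882728548787100, 6879382769263516, 6889280521397148, 6882683451630492,
  6888198189638556, 6879539535569820, 6863046861153180, 6889278071923612, 6882681002156956,
  6862941332464540, 6863044411679644, 6879582183252892, 6862891856454556, 6888386782323612,
  6888375508034460, 6879583709979548, 6888181831852956, 6889415561208732, 6879382517605276,
  6889409118757788, 6865108193797020, 6862663983350684, 6889278285071260, 6882681215304604,
  6862941545612188, 6879537299243932, 6863044624827292, 6862628012999580, 6864930115470236,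
  6879396169302940, 6862632911946652, 6888196481794972, 6889278108910492, 6882681039143836,
  6862941369451420, 6879582220239772, 6879514574504860, 6862893051069340, 6888387976938396,
  6862634547725212, 6862892245762972, 6888178865718172, 6865089121534876, 6862666759979932,
  6889329916953500, 6882732847186844, 6862634292396956, 6865088866206620, 6889410192262044,
  6862666492068764, 6889329649042332, 6889410179679132, 6889281330660252, 6889409988838300,
  6879591693599644, 6879583640535964, 6889278119920540, 6882681050153884, 6863044459676572,
  6879401842623388, 6879514585514908, 6862893062079388, 6888387987948444, 6879514988168092,
  6889278371578780, 6882681301812124, 6862941632119708, 6865091263251356, 6862941536371612,
  6879537290003356, 6863044615586716, 6864930106229660, 6889278074504092, 6882681004737436,
  6862941335045020, 6863044414260124, 6879401797206940, 6879582185833372, 6862634513318812,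
  6862632902706076, 6882728878523292, 6888196506108828, 6879537852040092, 6863045177623452,
  6879513467405212, 6888386869838748, 6888178563924892, 6865088819741596, 6862666458186652,
  6862632132002716, 6889415548060572, 6879382504457116, 6889278377542556, 6862628105470876,
  6889278352376732, 6882681282610076, 6862628080305052, 6888180988232604, 6862893045281692,
  6888387971150748, 6862892239975324, 6865089115747228, 6862666754192284, 6889329911165852,
  6882732841399196, 6889408965407644, 6882683046622108, 6888197784630172, 6865108040446876,
  6879539130561436, 6863046456144796, 6862634290279324, 6865088864088988, 6889410190144412,
  6879591894905756, 6862628609094556, 6862634246239132, 6888386870145948, 6862666458493852,
  6889329615467420, 6889415548367772, 6879382504764316, 6889409105916828, 6889278377849756,
  6882681308083100, 6862628105778076, 6888181013705628, 6879402100552604, 6862941332206492,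
  6879582182994844, 6879396157223836, 6862632899867548, 6888181831594908, 6889415560950684,
  6889409118499740, 6865108193538972, 6865102327018396, 6862663859336092, 6862891861701532,
  6888386787570588, 6879591768290204, 6888375513281436, 6879583715226524, 6888374900913052,
  6879514920252316, 6879513510966172, 6862634289492892, 6889410189357980, 6879591894119324,
  6889281340339100, 6862891853443996, 6888386779313052, 6879583706968988, 6888181828842396,
  6889409115747228, 6865108190786460, 6879539280901020, 6863046606484380, 6879514383512476,
  6888387785946012, 6864931602199452, 6879395978310556, 6882728872932252, 6889409989211036,
  6879591693972380, 6862655027311516, 6889278120293276, 6882681050526620, 6863044460049308,
  6879401842996124, 6879514585887644, 6888387988321180, 6862891837715356, 6888386763584412,
  6862632126411676, 6889415542469532, 6879382498866076, 6888180630320028, 6865090886136732,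
  6879582105793436, 6889418654643100, 6862892936623004, 6865108143502236, 6879539233616796,
  6863046559200156, 6862628068324252, 6864930170794908, 6888180976251804, 6862892242367388,
  6888178862322588, 6865089118139292, 6862666756584348, 6888374954423196, 6888181680894876,
  6889408967799708, 6889280118780828, 6882683049014172, 6888197787022236, 6865108042838940,
  6879539132953500, 6863046458536860, 6888180623930268, 6865090879746972, 6879401710777244,
  6879582099403676, 6879513514144668, 6862634292671388, 6888178610664348, 6865088866481052,
  6889410192536476, 6889281343517596, 6888180606366620, 6865090862183324, 6879401693213596,
  6889418630689692, 6862892912669596, 6888387838538652, 6879395653415836, 6879382768513948,
  6889280520647580, 6882683450880924, 6888198188888988, 6865108444705692, 6879539534820252,
  6863046860403612, 6889410174972828, 6862941331714972, 6879401793876892, 6879582182503324,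
  6862632899376028, 6879401691640732, 6879582080267164, 6889418629116828, 6862892911096732,
  6888387836965788, 6889415810544540, 6879382766941084, 6889280519074716, 6882683449308060,
  6888198187316124, 6865108443132828, 6879539533247388, 6863046858830748, 6888178591527836,
  6862666485789596, 6889329642763164, 6889410173399964, 6879583707657116, 6879514384200604,
  6889418578785180, 6888387786634140, 6889409072395164, 6889415716172700, 6889278109447068,
  6882681039680412, 6862941369987996, 6863044449203100, 6879582220776348, 6879514575041436,
  6862893051605916, 6862634548261788, 6862892246299548, 6879395619849788, 6862942137009724,
  6888196544710204, 6879537890641468, 6863045216224828, 6864930706867772, 6888386865448508,
  6865088815351356, 6889329610769980, 6862663983351356, 6889278285071932, 6882681215305276,
  6862941545612860, 6879537299244604, 6863044624827964, 6864930115470908, 6862892220597820,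
  6862632911947324, 6889415715636796, 6888196481795644, 6889278108911164, 6882681039144508,
  6862941369452092, 6879582220240444, 6879514574505532, 6862893051070012, 6888387976939068,
  6862634547725884, 6862892245763644, 6888178865718844, 6865089121535548, 6862666759980604,
  6889329916954172, 6882732847187516, 6865090879473212, 6879401710503484, 6879582099129916,
  6879513513870908, 6865088866207292, 6889410192262716, 6889281343243836, 6882728552744508,
  6889415816824380, 6879382773220924, 6889280525354556, 6888198193595964, 6879539539527228,
  6879513501287996, 6865088853624380, 6862666492069436, 6889329649043004, 6889410179679804,
  6889278277207612, 6879537291380284, 6863044616963644, 6864930107606588, 6889278075881020,
  6882681006114364, 6862941336421948, 6863044415637052, 6889409988838972, 6879591693600316,
  6879583640536636, 6889278119921212, 6882681050154556, 6863044459677244, 6879401842624060,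
  6879514585515580, 6862893062080060, 6888387987949116, 6879514988168764, 6879513360778812,
  6862891837343292, 6888386763212348, 6889415542097468, 6879382498494012, 6889278371579452,
  6882681301812796, 6862941632120380, 6865091263252028, 6879402094282300, 6864930532695612,
  6862655005335100, 6888375416987196, 6879583618932284, 6879400411733564, 6862891853487676,
  6888386779356732, 6879514383556156, 6889418578140732, 6888387785989692, 6864931602243132,
  6888374976585276, 6888181703056956, 6889408989961788, 6889280140942908, 6882683071176252,
  6879514995924540, 6879400387878460, 6862667195293244, 6882733282500156, 6862663974067772,
  6864930106187324, 6889278074461756, 6882681004695100, 6862941335002684, 6863044414217788,
  6879401797164604, 6879582185791036, 6862634513276476, 6862892211314236, 6862632902663740,
  6879395631537724, 6879382746635836, 6888198167010876, 6865108422827580, 6863046838525500,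
  6862942148697660, 6888196556398140, 6862628616085052, 6879396115979836, 6862663983537724,
  6879537299430972, 6863044625014332, 6862628013186620, 6864930115657276, 6862632098438716,
  6889415514496572, 6879382470893116, 6889409072045628, 6865108147084860, 6879539237199420,
  6863046562782780, 6882728451743292, 6889415715823164, 6882681039330876, 6862941369638460,
  6863044448853564, 6879582220426812, 6879514574691900, 6862893051256380, 6862634547912252,
  6888191750807100, 6865102006623804, 6865089121721916, 6862666760166972, 6882732847373884,
  6862632841879100, 6888192058039868, 6865102313856572, 6879539504586300, 6879537893973564,
  6863045219556924, 6879513466347068, 6862634244873788, 6888386868780604, 6888178562866748,
  6865088818683452, 6862666457128508, 6889329614102076, 6889278284471868, 6862941545012796,
  6879537298644540, 6863044624227900, 6865101980671548, 6862632861015612, 6879395632614460,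
  6882728527236156, 6879382747712572, 6865102316211260, 6879395631828028, 6882728526449724,
  6879382746926140, 6862628616375356, 6879395619900476, 6882728514522172, 6882683417365564,
  6865108411190332, 6879539501304892, 6863046826888252, 6862942137060412, 6879537890692156,
  6863045216275516, 6862628604447804, 6864930706918460, 6865088815402044, 6882732541054012,
  6879513362402364, 6862891838966844, 6879591745555516, 6882681303436348, 6862941633743932,
  6862628101131324, 6865091264875580, 6879402095905852, 6862663983402044, 6862628013050940,
  6864930115521596, 6862634522610748, 6862892220648508, 6865101981322300, 6879396169354300,
  6862632911998012, 6882681039195196, 6862941369502780, 6879582220291132, 6879514574556220,
  6862893051120700, 6862634547776572, 6862892245814332, 6865102006488124, 6865089121586236,
  6862666760031292, 6882732847238204, 6882681281416252, 6862628079111228, 6864930181581884,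
  6862628431432764, 6864930533903420, 6879400412941372, 6862667220356156, 6862663999130684,
  6862632842140732, 6862663846435900, 6862655006940220, 6879400387910716, 6882733282532412,
  6862941536361532, 6879537289993276, 6863044615576636, 6864930106219580, 6882681004727356,
  6862941335034940, 6863044414250044, 6879401797196860, 6879582185823292, 6862634513308732,
  6862892211346492, 6862632902695996, 6864930515164220, 6882681212345404, 6862941542652988,
  6879537296284732, 6863044621868092, 6864930112511036, 6864931592051772, 6862941363685180,
  6863044442900284, 6862893045303100, 6888387971172156, 6862892239996732, 6888178859951932,
  6865089115768636, 6862666754213692, 6889329911187260, 6882732841420604, 6889408965429052,
  6889280116410172, 6882683046643516, 6888197784651580, 6865108040468284, 6879539130582844,
  6863046456166204, 6888374901720892, 6879514921060156, 6879513511774012, 6862634290300732,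
  6865088864110396, 6889410190165820, 6879591894927164, 6879537895360316, 6863045220943676,
  6879382504785724, 6889278377871164, 6882681308104508, 6888181013727036, 6865091269543740,
  6879402100574012, 6862891856217916, 6888375507797820, 6879583709742908, 6888181831616316,
  6862632144914236, 6889415560972092, 6879382517368636, 6889409118521148, 6865108193560380,
  6879539283674940, 6889415816300348, 6879382772696892, 6889280524830524, 6882683455063868,
  6879513500763964, 6888178597283644, 6865088853100348, 6862666491545404, 6889329648518972,
  6889281330136892, 6889278276683580, 6882681206916924, 6862941537224508, 6879537290856252,
  6863044616439612, 6865101914163004, 6889329824679740, 6889280499664700, 6882683429898044,
  6888198167906108, 6865108423722812, 6862942149592892, 6888196557293372, 6879537903224636,
  6862628616980284, 6862655004593980, 6888375416246076, 6879583618191164, 6879400410992444,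
  6862663997181756, 6862632860766012, 6862632097402684, 6879382469857084, 6865108146048828,
  6879539236163388, 6863046561746748, 6888180978798396, 6888196480945980, 6879513500962620,
  6888178597482300, 6865088853299004, 6862666491744060, 6889329648717628, 6889281330335548,
  6889278276882236, 6882681207115580, 6879537291054908, 6863044616638268, 6864930107281212,
  6882681005788988, 6863044415311676, 6879582186884924, 6865101914361660, 6889329824878396,
  6888192061198140, 6865102317014844, 6862663849332540, 6879395632631612, 6889415791333180,
  6879382747729724, 6889280499863356, 6882683430096700, 6862942137077564, 6863045216292668,
  6862628604464956, 6864930706935612, 6862634241609532, 6888386865516348, 6888178559602492,
  6865088815419196, 6889329610837820, 6879513362419516, 6862891838983996, 6888386764853052,
  6879591745572668, 6862941633761084, 6862628101148476, 6888181009076028, 6865091264892732,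
  6879539504467772, 6879537893855036, 6863045219438396, 6862628607610684, 6879513466228540,
  6862634244755260, 6888386868662076, 6862666457009980, 6889329613983548, 6862628431449916,
  6864930533920572, 6888192211013436, 6879400412958524, 6862667220373308, 6889415510708028,
  6879382467104572, 6889409068257084, 6865108143296316, 6879539233410876, 6862628068118332,
  6864930170588988, 6889408967593788, 6882683048808252, 6888197786816316, 6879539132747580,
  6863046458330940, 6879401710571324, 6879582099197756, 6879513513938748, 6862634292465468,
  6865088866275132, 6889281343311676, 6862941536227132, 6879537289858876, 6863044615442236,
  6864930106085180, 6882728878378812, 6888196505964348, 6879537851895612, 6863045177478972,
  6888192060002108, 6865102315818812, 6862663848136508, 6879395631435580, 6879382746533692,
  6888198166908732, 6865108422725436, 6863046838423356, 6862942148595516, 6888196556295996,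
  6889415547916092, 6879382504312636, 6862628080160572, 6864930182631228, 6888180988088124,
  6888180606406460, 6865090862223164, 6879401693253436, 6889418630729532, 6862892912709436,
  6888387838578492, 6879395653455676, 6882728548077372, 6879382768553788, 6889280520687420,
  6882683450920764, 6888198188928828, 6865108444745532, 6879539534860092, 6863046860443452,
  6889410175012668, 6879591879774012, 6889281325993788, 6882681001447228, 6862941331754812,
  6863044410969916, 6879396156772156, 6862632899415868, 6889415721324348, 6862942079782716,
  6888196487483196, 6863045158997820, 6888374913175356, 6879514932514620, 6864931601747772,
  6879395977858876, 6882728872480572]"

definition words :: "nat list list" where
  "words = map (walk 54 0) codes"

definition well_formed :: "nat list \<Rightarrow> bool" where
  "well_formed v \<longleftrightarrow>
     take 6 v = stem \<and> take 6 (rev v) = stem \<and> aperiodic v (take 1 v) (drop 1 v) \<and> borderless v (drop 1 v)"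

section \<open>Equations for the evaluation\<close>

text \<open>The defining equations are specialised to the three letters: rules without \<open>if\<close> let the
  simplifier skip the instances of their variables, which are already in normal form.\<close>

lemma walk_numeral:
  "walk (numeral k) x c = x # walk (pred_numeral k) ((x + 1 + c mod 2) mod 3) (c div 2)"
  by (simp only: numeral_eq_Suc walk.simps)

lemma take_numeral_Cons: "take (numeral k) (x # xs) = x # take (pred_numeral k) xs"
  by (simp only: numeral_eq_Suc take_Suc_Cons)

lemma walk_rules:
  "walk 0 x n = []"
  "walk (numeral k) 0 (numeral (num.Bit0 c)) = 0 # walk (pred_numeral k) 1 (numeral c)"
  "walk (numeral k) 0 (numeral (num.Bit1 c)) = 0 # walk (pred_numeral k) 2 (numeral c)"
  "walk (numeral k) 0 (numeral num.One) = 0 # walk (pred_numeral k) 2 0"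
  "walk (numeral k) 0 0 = 0 # walk (pred_numeral k) 1 0"
  "walk (numeral k) 1 (numeral (num.Bit0 c)) = 1 # walk (pred_numeral k) 2 (numeral c)"
  "walk (numeral k) 1 (numeral (num.Bit1 c)) = 1 # walk (pred_numeral k) 0 (numeral c)"
  "walk (numeral k) 1 (numeral num.One) = 1 # walk (pred_numeral k) 0 0"
  "walk (numeral k) 1 0 = 1 # walk (pred_numeral k) 2 0"
  "walk (numeral k) 2 (numeral (num.Bit0 c)) = 2 # walk (pred_numeral k) 0 (numeral c)"
  "walk (numeral k) 2 (numeral (num.Bit1 c)) = 2 # walk (pred_numeral k) 1 (numeral c)"
  "walk (numeral k) 2 (numeral num.One) = 2 # walk (pred_numeral k) 1 0"
  "walk (numeral k) 2 0 = 2 # walk (pred_numeral k) 0 0"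
  by (simp_all add: walk_numeral flip: numeral_2_eq_2)

lemma letter_rules:
  "ord_class.lexordp (0 # x) (1 # y :: nat list) = True"
  "ord_class.lexordp (0 # x) (2 # y :: nat list) = True"
  "ord_class.lexordp (1 # x) (2 # y :: nat list) = True"
  "ord_class.lexordp (a # x) (a # y :: nat list) = ord_class.lexordp x y"
  "aperiodic_run (0 # x :: nat list) (0 # y) (c # k) l = aperiodic_run x y k l"
  "aperiodic_run (0 # x :: nat list) (1 # y) (c # k) l = aperiodic_run x y l l"
  "aperiodic_run (0 # x :: nat list) (2 # y) (c # k) l = aperiodic_run x y l l"
  "aperiodic_run (1 # x :: nat list) (0 # y) (c # k) l = aperiodic_run x y l l"
  "aperiodic_run (1 # x :: nat list) (1 # y) (c # k) l = aperiodic_run x y k l"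
  "aperiodic_run (1 # x :: nat list) (2 # y) (c # k) l = aperiodic_run x y l l"
  "aperiodic_run (2 # x :: nat list) (0 # y) (c # k) l = aperiodic_run x y l l"
  "aperiodic_run (2 # x :: nat list) (1 # y) (c # k) l = aperiodic_run x y l l"
  "aperiodic_run (2 # x :: nat list) (2 # y) (c # k) l = aperiodic_run x y k l"
  "residue (0 # x :: nat list) (0 # y) (c # k) = residue x y k"
  "residue (0 # x :: nat list) (1 # y) (c # k) = c # k"
  "residue (0 # x :: nat list) (2 # y) (c # k) = c # k"
  "residue (1 # x :: nat list) (0 # y) (c # k) = c # k"
  "residue (1 # x :: nat list) (1 # y) (c # k) = residue x y k"
  "residue (1 # x :: nat list) (2 # y) (c # k) = c # k"
  "residue (2 # x :: nat list) (0 # y) (c # k) = c # k"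
  "residue (2 # x :: nat list) (1 # y) (c # k) = c # k"
  "residue (2 # x :: nat list) (2 # y) (c # k) = residue x y k"
  "differs (0 # x :: nat list) (0 # y) (c # k) = differs x y k"
  "differs (0 # x :: nat list) (1 # y) (c # k) = True"
  "differs (0 # x :: nat list) (2 # y) (c # k) = True"
  "differs (1 # x :: nat list) (0 # y) (c # k) = True"
  "differs (1 # x :: nat list) (1 # y) (c # k) = differs x y k"
  "differs (1 # x :: nat list) (2 # y) (c # k) = True"
  "differs (2 # x :: nat list) (0 # y) (c # k) = True"
  "differs (2 # x :: nat list) (1 # y) (c # k) = True"
  "differs (2 # x :: nat list) (2 # y) (c # k) = differs x y k"
  "has_path 0 (0 # q) (Node t0 t1 t2) = has_path 0 q t0"
  "has_path 0 (1 # q) (Node t0 t1 t2) = has_path 0 q t1"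
  "has_path 0 (2 # q) (Node t0 t1 t2) = has_path 0 q t2"
  "has_path 1 (0 # q) (Node t0 t1 t2) = has_path 1 q t1"
  "has_path 1 (1 # q) (Node t0 t1 t2) = has_path 1 q t2"
  "has_path 1 (2 # q) (Node t0 t1 t2) = has_path 1 q t0"
  "has_path 2 (0 # q) (Node t0 t1 t2) = has_path 2 q t2"
  "has_path 2 (1 # q) (Node t0 t1 t2) = has_path 2 q t0"
  "has_path 2 (2 # q) (Node t0 t1 t2) = has_path 2 q t1"
  "insert_word (0 # w) Leaf = Node (insert_word w Leaf) Leaf Leaf"
  "insert_word (1 # w) Leaf = Node Leaf (insert_word w Leaf) Leaf"
  "insert_word (2 # w) Leaf = Node Leaf Leaf (insert_word w Leaf)"
  "insert_word (0 # w) (Node t0 t1 t2) = Node (insert_word w t0) t1 t2"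
  "insert_word (1 # w) (Node t0 t1 t2) = Node t0 (insert_word w t1) t2"
  "insert_word (2 # w) (Node t0 t1 t2) = Node t0 t1 (insert_word w t2)"
  by simp_all

lemma list_rules:
  "aperiodic_run x [] (c # k) l = True"
  "aperiodic_run x y [] l = False"
  "residue x [] k = k"
  "residue x y [] = []"
  "differs [] y k = False"
  "differs x [] k = False"
  "differs x y [] = False"
  "emit_pair True rl k = []"
  "emit_pair False rl k = [take (length k) rl]"
  "emit_overlap True p rl r = []"
  "emit_overlap False p rl r = [(r, take (reach p (length r)) rl)]"
  "reach (a, b, c) (length [x1]) = a"
  "reach (a, b, c) (length [x1, x2, x3, x4, x5]) = b"
  "reach (a, b, c) (length (x1 # x2 # x3 # x4 # x5 # x6 # r)) = c"
  "take (length []) hs = []"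
  "take (length (z # zs)) (h # hs) = h # take (length zs) hs"
  "take 1 (h # hs) = [h]"
  "drop 1 (h # hs) = hs"
  by (cases x; cases y; simp add: emit_pair_def emit_overlap_def)+

lemmas rules = walk_rules letter_rules list_rules
  pred_numeral_simps num.inject BitM.simps take_0 take_Nil take_numeral_Cons
  rev_conv_fold fold_simps list.map append.simps list.pred_inject successively.simps
  HOL.simp_thms
  has_path.simps(1,2) insert_word.simps(1,2) trie_of.simps aperiodic.simps borderless.simps collect.simps
  query_pair_def pair_queries_def overlap_queries_def absent_def overlap_ok.simps certified_def
  all_certified_def well_formed_def

section \<open>Evaluation for the explicit words\<close>

lemma well_formed_words: "list_all well_formed words"
  unfolding words_def codes_def by (simp only: rules)

text \<open>The codes are listed in the lexicographic order of their words, so comparing neighbours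
  suffices for distinctness.\<close>

lemma increasing_words: "successively ord_class.lexordp words"
  unfolding words_def codes_def by (simp only: rules)

text \<open>The three numbers are the admitted overlaps plus one, next to a border of length 1, of
  length 2 to 5, and of length at least 6; they exceed what occurs in the given words.\<close>

lemma certified_words: "all_certified (3, 2, 35) words"
  unfolding words_def codes_def by (simp only: rules)

text \<open>Diminished by one, the limits of both directions must add up to less than 54, and to
  less than \<open>54 - 2 * e\<close> if a word has a border of length \<open>e\<close>. For long
  overlaps, 34 + 19 = 53; for five letters, 1 + 42 = 43, while \<open>54 - 2 * 5\<close> is 44.
  Neither sum could be larger.\<close>

lemma certified_rev_words: "all_certified (3, 43, 20) (map rev words)"
  unfolding words_def codes_def by (simp only: rules)

lemma words_properties:
  assumes "v \<in> set words"
  shows "length v = 54" "set v \<subseteq> Sigma3" "take 6 v = stem" "take 6 (rev v) = stem"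
    "squarefree_word v" "borderless v (drop 1 v)"
proof -
  show "length v = 54" "set v \<subseteq> Sigma3" using assms set_walk[of 0] by (auto simp: words_def)
  have "well_formed v" using assms well_formed_words by (simp add: list_all_iff)
  then show "take 6 v = stem" "take 6 (rev v) = stem" "squarefree_word v" "borderless v (drop 1 v)"
    by (auto simp: well_formed_def intro: squarefree_word_aperiodic)
qed

lemma alphabet_words_words: "alphabet_words 54 (set words)"
  unfolding alphabet_words_def
proof (intro ballI conjI)
  fix v assume v: "v \<in> set words"
  note * = words_properties[OF v]
  show "length v = 54" "set v \<subseteq> Sigma3" by (fact *)+
  have "v ! 0 = take 6 v ! 0" "v ! 53 = take 6 (rev v) ! 0" using *(1) by (simp_all add: rev_nth)
  then show "v ! 0 = 0" "v ! (54 - 1) = 0" unfolding *(3,4) by simp_all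
qed

lemma card_words: "card (set words) = 952"
proof -
  have "transp (ord_class.lexordp :: nat list \<Rightarrow> nat list \<Rightarrow> bool)"
    by (rule transpI) (rule lexordp_trans)
  with increasing_words have "sorted_wrt ord_class.lexordp words"
    by (simp add: successively_conv_sorted_wrt)
  moreover have "distinct ws" if "sorted_wrt ord_class.lexordp ws" for ws :: "nat list list"
    using that by (induction ws) (auto simp: lexordp_irreflexive')
  ultimately have "distinct words" by blast
  moreover have "length codes = 952" by (simp add: codes_def)
  then have "length words = 952" by (simp add: words_def)
  ultimately show ?thesis by (simp add: distinct_card)
qed

section \<open>The special triple and its growth rate\<close>

lemma brinkhuis_words: "special_brinkhuis_triple 54 952 (\<lambda>d. rot d ` set words)"
proof -
  let ?F = "set words"
  have sep: "separated 54 ?F" and ov: "bounded_overlap 54 (\<lambda>e. reach (3, 2, 35) e - 1) ?F"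
    using separated_certified bounded_overlap_certified alphabet_words_words certified_words
      words_properties(3,4) by blast+
  have rev: "alphabet_words 54 (set (map rev words))"
    using alphabet_words_rev[OF alphabet_words_words] by simp
  have stems: "take 6 v = stem \<and> take 6 (rev v) = stem" if "v \<in> set (map rev words)" for v
    using that words_properties(3,4) by auto
  have sep': "separated 54 (rev ` ?F)"
    and ov': "bounded_overlap 54 (\<lambda>e. reach (3, 43, 20) e - 1) (rev ` ?F)"
    using separated_certified[OF rev certified_rev_words stems]
      bounded_overlap_certified[OF rev certified_rev_words stems] by simp_all
  have border: "e < 6" if "v \<in> ?F" "1 \<le> e" "2 * e < 54" "\<forall>k<e. v ! (54 - e + k) = v ! k" for v e
  proof (rule ccontr)
    assume "\<not> e < 6"
    note v = words_properties[OF that(1)] and e = that(3)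
    \<comment> \<open>After the first letter 53 letters remain, of which the last \<open>e\<close>
      start at index \<open>53 - e\<close>.\<close>
    have "differs v (drop (53 - e) (drop 1 v)) (drop (53 - e) (drop 1 v))"
      using v(1) that(3) \<open>\<not> e < 6\<close> by (intro borderless_drop v(6)) simp
    moreover have "53 - e + 1 = 54 - e" using that(3) by linarith
    then have "drop (53 - e) (drop 1 v) = drop (54 - e) v" by (simp only: drop_drop)
    ultimately obtain i where "i < e" "v ! i \<noteq> v ! (54 - e + i)"
      using differs_nth[of v "drop (54 - e) v" "drop (54 - e) v"] v(1) e by auto
    then show False using that(4) by simp
  qed
  have small: "reach (3, 2, 35) e - 1 + (reach (3, 43, 20) e - 1) < 54 - 2 * e" if "1 \<le> e" "e < 6" for e
    using that by simp arith
  have "reach (3, 2, 35) e - 1 + (reach (3, 43, 20) e - 1) < 54" for e by simp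
  then have three: "squarefree_word (rot a u @ rot b v @ rot c w)"
    if "u \<in> ?F" "v \<in> ?F" "w \<in> ?F" "a < 3" "b < 3" "c < 3" "a \<noteq> b" "b \<noteq> c" for a b c u v w
    using squarefree_three_rotations[OF alphabet_words_words sep sep' words_properties(5) ov ov' _ small]
      border that by blast
  have letters: "i < 3" if "i \<in> Sigma3" for i using that by (auto simp: Sigma3_def)
  have word: "rot d v \<in> squarefree_words 54" if "v \<in> ?F" for d v
  proof -
    have "set (rot d v) \<subseteq> Sigma3" by (auto simp: rot_def Sigma3_def)
    then show ?thesis using words_properties[OF that] by (auto simp: squarefree_words_def squarefree_word_rot)
  qed
  have card: "card (rot d ` ?F) = 952" for d
  proof -
    have "inj_on (rot d) ?F"
    proof (rule inj_on_inverseI)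
      fix v assume v: "v \<in> ?F"
      have "(x + (2 * d + d)) mod 3 = x" if "x < 3" for x :: nat using that by presburger
      moreover have "x < 3" if "x \<in> set v" for x using that words_properties(2)[OF v] letters by blast
      ultimately show "rot (2 * d) (rot d v) = v" unfolding rot_rot by (auto simp: rot_def intro!: map_idI)
    qed
    then show ?thesis by (simp add: card_image card_words)
  qed
  have "brinkhuis_triple 54 952 (\<lambda>d. rot d ` ?F)"
    unfolding brinkhuis_triple_def
  proof (intro conjI ballI impI)
    fix i1 i2 i3 u v w
    assume "i1 \<in> Sigma3" "i2 \<in> Sigma3" "i3 \<in> Sigma3" "squarefree_word [i1, i2, i3]"
      "u \<in> rot i1 ` ?F" "v \<in> rot i2 ` ?F" "w \<in> rot i3 ` ?F"
    then show "squarefree_word (u @ v @ w)"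
      using three letters by (auto simp: squarefree_word_3)
  qed (use word card in auto)
  then show ?thesis
    by (simp add: special_brinkhuis_triple_def map_tau image_image rot_rot numeral_2_eq_2)
qed

theorem theorem4:
  shows "(\<exists>B. special_brinkhuis_triple 54 952 B) \<and>
    convergent squarefree_root \<and>
    growth_rate \<ge> 952 powr (1 / 53) \<and>
    (952::real) powr (1 / 53) > 110 powr (1 / 42) \<and>
    \<bar>(952::real) powr (1 / 53) - 1.1381531\<bar> < 5 / 10 ^ 8 \<and>
    \<bar>(110::real) powr (1 / 42) - 1.1184191\<bar> < 5 / 10 ^ 8"
proof -
  have "brinkhuis_triple 54 952 (\<lambda>d. rot d ` set words)"
    using brinkhuis_words by (simp add: special_brinkhuis_triple_def)
  note growth = growth_rate_ge[OF this]
  have "convergent squarefree_root" "growth_rate \<ge> 952 powr (1 / 53)"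
    using growth by simp_all
  \<comment> \<open>The two decimal enclosures are disjoint, which already orders the roots.\<close>
  moreover have "(952::real) powr (1 / 53) > 110 powr (1 / 42)"
    using powr_952_bounds powr_110_bounds unfolding abs_diff_less_iff by simp
  ultimately show ?thesis using brinkhuis_words powr_952_bounds powr_110_bounds by blast
qed

end
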